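(* Let $1\le t\le m$ and let $I_{m,t}\subset k[x_1,\dots,x_m]$ be the square-free Veronese ideal of degree $t$, i.e. the ideal generated by all square-free monomials of degree $t$ in $x_1,\dots,x_m$ over a field $k$. Let $\Gamma_{m,t}$ be the labeled polytopal cell complex, supporting the multigraded minimal free resolution of $I_{m,t}$, defined recursively by $\Gamma_{p,1}=\Delta(x_1,\dots,x_p)$ for $1\le p\le m$ and $$\Gamma_{p,q}=\bigcup_{i=q-1}^{p-1}\bigl[\Gamma_{i,q-1}\times\Delta(x_{i+1},\dots,x_p)\bigr]\qquad(2\le q\le p\le m).$$ Then $\Gamma_{m,t}$ is a polytopal subdivision of the $(m-t)$-simplex $$\Delta(x_1\cdots x_t,\ x_2\cdots x_{t+1},\ \dots,\ x_{m-t+1}\cdots x_m).$$ In particular, $\Gamma_{m,t}$ is shellable and its underlying topological space is homeomorphic to a closed ball.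
   Context: Labeled complexes and cellular resolutions: let $I$ be a monomial ideal in a polynomial ring $R$ in $N$ variables over a field, with minimal monomial generating set $G(I)$. Let $X$ be a regular cell complex with vertices labeled by the elements of $G(I)$ and with an incidence function $\epsilon$. Each nonempty face $F$ is labeled by $\mathbf{m}_F$, the least common multiple of the labels of its vertices, and its degree is the exponent vector of $\mathbf{m}_F$ in $\mathbb{Z}^N$. The cellular complex $\mathbf{F}_X$ is the $\mathbb{Z}^N$-graded module $\bigoplus_{\emptyset\ne F\in X}RF$, where $RF$ is free with one generator in the degree of $F$, with differential $\partial(F)=\sum_{\emptyset\neq F'\in X}\epsilon(F,F')\frac{\mathbf{m}_F}{\mathbf{m}_{F'}}F'$, where $\epsilon(F,F')$ is nonzero only if $F'$ is a codimension-one face of $F$, in which case it is $\pm1$. One says $X$ supports a (minimal) free resolution of $I$ if $\mathbf{F}_X$ is a (minimal) free resolution of $I$. A polytopal cell complex is one whose cells are convex polytopes, any two meeting in a common (possibly empty) face. Notation: $\Delta(u_1,\dots,u_r)$ denotes the $(r-1)$-simplex whose vertices are labeled by the monomials $u_1,\dots,u_r$. If $X,Y$ are labeled complexes whose labels involve disjoint sets of variables, $X\times Y$ is the complex with cells $F\times G$ ($F\in X$, $G\in Y$), the vertex $(v,w)$ being labeled by the product of the labels of $v$ and $w$. In the unions, vertices with the same label are identified, and faces with the same set of vertex labels are identified. That $\Gamma_{m,t}$ is a polytopal subdivision of the stated simplex means that it is realized in $\mathbb{R}^{m-t}$ as a polytopal complex whose underlying space is an $(m-t)$-simplex, the vertices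 of this simplex being the vertices of $\Gamma_{m,t}$ labeled by $x_1\cdots x_t,\ x_2\cdots x_{t+1},\dots,x_{m-t+1}\cdots x_m$. Shellable means shellable as a polytopal complex. *)

theory Defs
  imports "HOL-Analysis.Analysis" "HOL-Library.Poly_Mapping"
begin

section \<open>Monomials and the square-free Veronese ideal\<close>

text \<open>Exponent vectors are finitely supported functions, so \<open>'k mpoly\<close> is the polynomial ring over
  \<open>'k\<close> in the variables indexed by all natural numbers; \<open>k[x_1, ..., x_m]\<close> is the subring of those
  polynomials that only involve the variables with index in \<open>{1..m}\<close>.\<close>

type_synonym 'k mpoly = "(nat \<Rightarrow>\<^sub>0 nat) \<Rightarrow>\<^sub>0 'k"

definition monomial :: "(nat \<Rightarrow>\<^sub>0 nat) \<Rightarrow> 'k::field mpoly"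
  where "monomial a = Poly_Mapping.single a 1"

definition var :: "nat \<Rightarrow> 'k::field mpoly"
  where "var i = monomial (Poly_Mapping.single i 1)"

definition poly_ring :: "nat \<Rightarrow> 'k::field mpoly set"
  where "poly_ring m = {f. \<forall>a \<in> Poly_Mapping.keys f. Poly_Mapping.keys a \<subseteq> {1..m}}"

definition squarefree_monomials :: "nat \<Rightarrow> nat \<Rightarrow> 'k::field mpoly set"
  where "squarefree_monomials m t = {\<Prod>i\<in>S. var i | S. S \<subseteq> {1..m} \<and> card S = t}"

definition squarefree_veronese :: "nat \<Rightarrow> nat \<Rightarrow> 'k::field mpoly set"
  where "squarefree_veronese m t =
    {\<Sum>u\<in>squarefree_monomials m t. c u * u | c. \<forall>u. c u \<in> poly_ring m}"

definition min_monomial_gens :: "'k::field mpoly set \<Rightarrow> 'k mpoly set"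
  where "min_monomial_gens I =
    {u \<in> I \<inter> range monomial. \<forall>v \<in> I \<inter> range monomial. v dvd u \<longrightarrow> v = u}"


section \<open>The labeled complex \<open>\<veronese_complex>\<close>\<close>

text \<open>Faces of \<open>\<veronese_complex>\<close> with the same set of vertex labels are identified. A labeled complex is
  therefore encoded as the family of the vertex-label sets of its cells (the empty cell included);
  one cell is a face of another iff its label set is contained in the other one.\<close>

definition label_simplex :: "'v set \<Rightarrow> 'v set set"
  where "label_simplex U = Pow U"

definition label_prod :: "'v::times set set \<Rightarrow> 'v set set \<Rightarrow> 'v set set"
  where "label_prod X Y = {{v * w | v w. v \<in> F \<and> w \<in> G} | F G. F \<in> X \<and> G \<in> Y}"

text \<open>The value at \<open>q = 0\<close> is a dummy.\<close>

fun veronese_complex :: "nat \<Rightarrow> nat \<Rightarrow> 'k::field mpoly set set" where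
  "veronese_complex p 0 = {}"
| "veronese_complex p (Suc 0) = label_simplex (var ` {1..p})"
| "veronese_complex p (Suc (Suc q)) =
     (\<Union>i\<in>{Suc q..p - 1}. label_prod (veronese_complex i (Suc q)) (label_simplex (var ` {i+1..p})))"

lemma Union_label_prod:
  "\<Union>(label_prod X Y) = {v * w | v w. v \<in> \<Union>X \<and> w \<in> \<Union>Y}"
  unfolding label_prod_def by blast

lemma Union_veronese_complex:
  assumes "1 \<le> q" "q \<le> p"
  shows "\<Union>(veronese_complex p q) = (squarefree_monomials p q :: 'k::field mpoly set)"
  using assms
proof (induction p q rule: veronese_complex.induct)
  case (1 p)
  then show ?case by simp
next
  case (2 p)
  have "{\<Prod>i\<in>S. var i | S. S \<subseteq> {1..p} \<and> card S = 1} = (var ` {1..p} :: 'k mpoly set)"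
  proof (intro equalityI subsetI)
    fix u :: "'k mpoly" assume "u \<in> var ` {1..p}"
    then obtain i where "i \<in> {1..p}" "u = (\<Prod>j\<in>{i}. var j)" by auto
    then show "u \<in> {\<Prod>i\<in>S. var i | S. S \<subseteq> {1..p} \<and> card S = 1}"
      by (intro CollectI exI[of _ "{i}"]) auto
  qed (auto simp: card_1_singleton_iff)
  then show ?case
    by (simp add: label_simplex_def squarefree_monomials_def)
next
  case (3 p q)
  let ?m = "\<lambda>S. \<Prod>i\<in>S. var i :: 'k mpoly"
  have IH: "\<Union>(veronese_complex i (Suc q)) = (squarefree_monomials i (Suc q) :: 'k mpoly set)"
    if "i \<in> {Suc q..p - 1}" for i
    using 3 that by auto
  have "\<Union>(veronese_complex p (Suc (Suc q)) :: 'k mpoly set set) =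
      (\<Union>i\<in>{Suc q..p - 1}. {v * w | v w. v \<in> squarefree_monomials i (Suc q) \<and> w \<in> var ` {i+1..p}})"
    (is "_ = ?A")
  proof -
    have "\<Union>(veronese_complex p (Suc (Suc q)) :: 'k mpoly set set) =
      (\<Union>i\<in>{Suc q..p - 1}. \<Union>(label_prod (veronese_complex i (Suc q)) (label_simplex (var ` {i+1..p}))))"
      by (simp del: Union_iff) blast
    also have "\<dots> = ?A"
      by (intro SUP_cong refl) (simp only: Union_label_prod IH label_simplex_def Union_Pow_eq)
    finally show ?thesis .
  qed
  also have "?A = squarefree_monomials p (Suc (Suc q))"
  proof (intro equalityI subsetI)
    fix u assume "u \<in> ?A"
    then obtain i S j where *: "i \<in> {Suc q..p - 1}" "S \<subseteq> {1..i}" "card S = Suc q"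
      "j \<in> {i+1..p}" "u = ?m S * var j"
      by (auto simp: squarefree_monomials_def)
    have "finite S" "j \<notin> S" using * by (auto intro: card_ge_0_finite)
    then have "u = ?m (insert j S)" "insert j S \<subseteq> {1..p}" "card (insert j S) = Suc (Suc q)"
      using * by (auto simp: mult.commute)
    then show "u \<in> squarefree_monomials p (Suc (Suc q))"
      unfolding squarefree_monomials_def by blast
  next
    fix u :: "'k mpoly" assume "u \<in> squarefree_monomials p (Suc (Suc q))"
    then obtain S where S: "S \<subseteq> {1..p}" "card S = Suc (Suc q)" "u = ?m S"
      by (auto simp: squarefree_monomials_def)
    have fin: "finite S" and ne: "S \<noteq> {}" using S by (auto intro: card_ge_0_finite)
    define j where "j = Max S"
    have j: "j \<in> S" "\<And>s. s \<in> S \<Longrightarrow> s \<le> j" using fin ne by (auto simp: j_def)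
    let ?T = "S - {j}"
    have "s \<in> {1..j - 1}" if "s \<in> ?T" for s
      using that j(2)[of s] S(1) by fastforce
    then have T: "?T \<subseteq> {1..j - 1}" by blast
    have "card ?T = Suc q" using j(1) S(2) fin by simp
    note T = T this
    then have "Suc q \<le> j - 1" using card_mono[OF _ T(1)] by simp
    moreover have "u = ?m ?T * var j"
      using S fin j by (simp add: prod.remove mult.commute)
    moreover have "?m ?T \<in> squarefree_monomials (j - 1) (Suc q)"
      using T unfolding squarefree_monomials_def by blast
    moreover have "j \<in> {1..p}" using j(1) S(1) by blast
    then have "j \<in> {j - 1 + 1..p}" "j - 1 \<in> {Suc q..p - 1}"
      using \<open>Suc q \<le> j - 1\<close> by auto
    ultimately show "u \<in> ?A" by blast
  qed
  finally show ?case .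
qed

lemma prod_var: "(\<Prod>i\<in>S. var i) = (monomial (\<Sum>i\<in>S. Poly_Mapping.single i 1) :: 'k::field mpoly)"
  by (induction S rule: infinite_finite_induct)
     (simp_all add: monomial_def var_def mult_single)

lemma inj_monomial: "inj (monomial :: _ \<Rightarrow> 'k::field mpoly)"
proof (rule injI)
  fix a b :: "nat \<Rightarrow>\<^sub>0 nat" assume "monomial a = (monomial b :: 'k mpoly)"
  then have "Poly_Mapping.keys (monomial a :: 'k mpoly) = Poly_Mapping.keys (monomial b :: 'k mpoly)"
    by simp
  then show "a = b" by (simp add: monomial_def)
qed

lemma keys_mult_monomial:
  assumes "b \<in> Poly_Mapping.keys (f * monomial a :: 'k::field mpoly)"
  obtains c where "b = c + a"
proof -
  have "Poly_Mapping.keys (monomial a :: 'k mpoly) = {a}"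
    by (simp add: monomial_def)
  then show ?thesis
    using that assms keys_mult[of f "monomial a"] by auto
qed

text \<open>The vertices of \<open>\<Gamma>\<close> are labeled by the minimal monomial generators of the ideal.\<close>

theorem vertices_veronese_complex:
  assumes "1 \<le> t" "t \<le> m"
  shows "\<Union>(veronese_complex m t) =
    min_monomial_gens (squarefree_veronese m t :: 'k::field mpoly set)"
proof -
  let ?I = "squarefree_veronese m t :: 'k mpoly set"
  let ?G = "squarefree_monomials m t :: 'k mpoly set"
  define e where "e S = (\<Sum>i\<in>S. Poly_Mapping.single i 1 :: nat \<Rightarrow>\<^sub>0 nat)" for S
  have G: "?G = {monomial (e S) | S. S \<subseteq> {1..m} \<and> card S = t}"
    by (simp add: squarefree_monomials_def prod_var e_def)
  have finG: "finite ?G"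
  proof -
    have "?G \<subseteq> (\<lambda>S. monomial (e S)) ` Pow {1..m}" by (auto simp: G)
    then show ?thesis using finite_subset by blast
  qed
  have lookup_e: "Poly_Mapping.lookup (e S) i = (if i \<in> S then 1 else 0)" if "finite S" for S i
    using that unfolding e_def
    by (induction S) (auto simp: lookup_add lookup_single when_def)
  have GI: "?G \<subseteq> ?I"
  proof
    fix u assume u: "u \<in> ?G"
    have "u = (\<Sum>v\<in>?G. (if v = u then 1 else 0) * v)"
      using u finG by (simp add: if_distrib[of "\<lambda>x. x * _"] sum.delta cong: if_cong)
    moreover have "\<forall>v. (if v = u then 1 else 0) \<in> (poly_ring m :: 'k mpoly set)"
      by (auto simp: poly_ring_def)
    ultimately show "u \<in> ?I"
      unfolding squarefree_veronese_def
      by (intro CollectI exI[of _ "\<lambda>v. if v = u then 1 else 0"]) blast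
  qed
  have I: "\<exists>S c. S \<subseteq> {1..m} \<and> card S = t \<and> b = c + e S" if b: "monomial b \<in> ?I" for b
  proof -
    obtain f where f: "monomial b = (\<Sum>u\<in>?G. f u * u)"
      using b by (auto simp: squarefree_veronese_def)
    have "b \<in> Poly_Mapping.keys (monomial b :: 'k mpoly)" by (simp add: monomial_def)
    then have "b \<in> (\<Union>u\<in>?G. Poly_Mapping.keys (f u * u))"
      unfolding f by (rule subsetD[OF keys_sum, rotated])
    then obtain u where "u \<in> ?G" "b \<in> Poly_Mapping.keys (f u * u)" by blast
    then show ?thesis unfolding G by (auto elim!: keys_mult_monomial)
  qed
  have "?G = min_monomial_gens ?I"
  proof (intro equalityI subsetI)
    fix u assume u: "u \<in> ?G"
    then obtain S where S: "S \<subseteq> {1..m}" "card S = t" "u = monomial (e S)" by (auto simp: G)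
    have "v = u" if v: "v \<in> ?I" "v = monomial b" "v dvd u" for v b
    proof -
      obtain T c where T: "T \<subseteq> {1..m}" "card T = t" "b = c + e T" using I v by blast
      obtain f where "u = f * monomial b" using v by (auto simp: dvd_def mult.commute)
      moreover have "e S \<in> Poly_Mapping.keys u" by (simp add: S monomial_def)
      ultimately obtain d where d: "e S = d + b" by (auto elim: keys_mult_monomial)
      have fin: "finite S" "finite T" using S T by (auto intro: finite_subset[OF _ finite_atLeastAtMost])
      have eq: "Poly_Mapping.lookup (e S) i =
          Poly_Mapping.lookup d i + (Poly_Mapping.lookup c i + Poly_Mapping.lookup (e T) i)" for i
        by (simp add: d T lookup_add)
      have "T \<subseteq> S"
      proof
        fix i assume "i \<in> T"
        then show "i \<in> S" using eq[of i] fin by (auto simp: lookup_e split: if_splits)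
      qed
      then have "T = S" using S T fin by (intro card_subset_eq) auto
      then have "d + c = 0" using d T by (simp add: add.assoc[symmetric])
      then have "Poly_Mapping.lookup (d + c) i = 0" for i by simp
      then have "d = 0" by (intro poly_mapping_eqI) (simp add: lookup_add)
      then show "v = u" using d S v by simp
    qed
    then show "u \<in> min_monomial_gens ?I"
      using u S GI by (auto simp: min_monomial_gens_def)
  next
    fix u assume u: "u \<in> min_monomial_gens ?I"
    then obtain b where b: "u = monomial b" "u \<in> ?I" by (auto simp: min_monomial_gens_def)
    then obtain S c where S: "S \<subseteq> {1..m}" "card S = t" "b = c + e S" using I by blast
    have "monomial (e S) \<in> ?G" using S by (auto simp: G)
    moreover have "u = monomial c * monomial (e S)"
      by (simp add: b S monomial_def mult_single)
    ultimately have "monomial (e S) \<in> ?I \<inter> range monomial" "monomial (e S) dvd u"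
      using GI by auto
    then have "monomial (e S) = u"
      using u unfolding min_monomial_gens_def by blast
    then show "u \<in> ?G" using \<open>monomial (e S) \<in> ?G\<close> by simp
  qed
  with Union_veronese_complex[OF assms] show ?thesis by (rule trans)
qed


section \<open>Polytopal complexes\<close>

definition polytopal_complex :: "'a::euclidean_space set set \<Rightarrow> bool"
  where "polytopal_complex K \<longleftrightarrow>
    finite K \<and>
    (\<forall>P\<in>K. polytope P) \<and>
    (\<forall>P\<in>K. \<forall>F. F face_of P \<longrightarrow> F \<in> K) \<and>
    (\<forall>P\<in>K. \<forall>Q\<in>K. (P \<inter> Q) face_of P \<and> (P \<inter> Q) face_of Q)"

definition realized_cells :: "'v set set \<Rightarrow> ('v \<Rightarrow> 'a::euclidean_space) \<Rightarrow> 'a set set"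
  where "realized_cells X \<phi> = (\<lambda>F. convex hull (\<phi> ` F)) ` X"

text \<open>A realization places the vertices of \<open>X\<close> at distinct points so that the convex hulls of the
  cells form a polytopal complex and the vertices of each hull are exactly those of the cell.
  As polytopes are determined by their vertices and a polytopal complex is closed under faces,
  \<open>F \<mapsto> convex hull (\<phi> ` F)\<close> is then an isomorphism of face posets.\<close>

definition polytopal_realization :: "'v set set \<Rightarrow> ('v \<Rightarrow> 'a::euclidean_space) \<Rightarrow> bool"
  where "polytopal_realization X \<phi> \<longleftrightarrow>
    inj_on \<phi> (\<Union>X) \<and>
    (\<forall>F\<in>X. {v. v extreme_point_of (convex hull (\<phi> ` F))} = \<phi> ` F) \<and>
    polytopal_complex (realized_cells X \<phi>)"

definition realizes_subdivision_of_simplex ::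
    "'v set set \<Rightarrow> nat \<Rightarrow> 'v set \<Rightarrow> ('v \<Rightarrow> 'a::euclidean_space) \<Rightarrow> bool"
  where "realizes_subdivision_of_simplex X n U \<phi> \<longleftrightarrow>
    polytopal_realization X \<phi> \<and>
    int n simplex (\<Union>(realized_cells X \<phi>)) \<and>
    U \<subseteq> \<Union>X \<and>
    {v. v extreme_point_of (\<Union>(realized_cells X \<phi>))} = \<phi> ` U"


section \<open>Shellability\<close>

definition facets :: "'a set set \<Rightarrow> 'a set set"
  where "facets K = {P \<in> K. \<forall>Q\<in>K. P \<subseteq> Q \<longrightarrow> P = Q}"

definition pure_complex :: "nat \<Rightarrow> 'a::euclidean_space set set \<Rightarrow> bool"
  where "pure_complex k K \<longleftrightarrow> (\<forall>P\<in>facets K. aff_dim P = int k)"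

definition boundary_complex :: "'a::euclidean_space set \<Rightarrow> 'a set set"
  where "boundary_complex P = {F. F face_of P \<and> F \<noteq> P}"

text \<open>Shellings of pure polytopal complexes as in Ziegler, Lectures on Polytopes, Definition 8.1:
  \<open>shelling k K Fs\<close> says that \<open>Fs\<close> is a shelling of the pure \<open>k\<close>-dimensional complex \<open>K\<close>. Every
  order of the facets of a \<open>0\<close>-dimensional complex is a shelling.\<close>

primrec shelling :: "nat \<Rightarrow> 'a::euclidean_space set set \<Rightarrow> 'a set list \<Rightarrow> bool" where
  "shelling 0 K Fs \<longleftrightarrow> pure_complex 0 K \<and> distinct Fs \<and> set Fs = facets K"
| "shelling (Suc k) K Fs \<longleftrightarrow>
     pure_complex (Suc k) K \<and> distinct Fs \<and> set Fs = facets K \<and>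
     (\<exists>Gs. shelling k (boundary_complex (hd Fs)) Gs) \<and>
     (\<forall>j. 0 < j \<and> j < length Fs \<longrightarrow>
        (\<exists>Gs r. shelling k (boundary_complex (Fs ! j)) Gs \<and> 1 \<le> r \<and> r \<le> length Gs \<and>
           Fs ! j \<inter> \<Union>(set (take j Fs)) = \<Union>(set (take r Gs))))"

definition shellable :: "'a::euclidean_space set set \<Rightarrow> bool"
  where "shellable K \<longleftrightarrow> polytopal_complex K \<and> (\<exists>k Fs. shelling k K Fs)"

end

theory Submission
  imports Defs
begin

text \<open>A cell of the complex is a product of \<open>t\<close> simplices on consecutive sets of variables. Let
  \<open>d = m - t\<close>, let \<open>v 0, ..., v d\<close> be affinely independent points of \<open>E\<close>, and send the monomial
  \<open>x_(a 0 + 1) x_(a 1 + 2) ... x_(a (t - 1) + t)\<close>, \<open>a\<close> weakly increasing, to \<open>v (a 0) + ... + v (a (t - 1))\<close>.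
  The cells become the Minkowski cells of the staircase triangulation of a product of two simplices:
  a point of the simplex with vertices \<open>t v 0, ..., t v d\<close> is a column-sum vector, and the northwest
  corner rule writes it uniquely as the column sums of a nonnegative matrix with row sums \<open>1\<close> and
  support in a staircase. Faces and intersections of cells are therefore read off from supports.

  The maximal cells, ordered by the height of the lattice path, form a shelling: such a cell meets
  the earlier ones in the facets opposite to its corners, and no row of the path consists of corners
  only, so these facets are an initial segment of a shelling of the boundary.\<close>

section \<open>Complexes of products of simplices\<close>

text \<open>The \<open>k\<close>-th smallest index of a square-free monomial, \<open>k\<close>
  counted from 0, becomes a column after subtracting \<open>k + 1\<close>. Strictly increasing
  indices turn into weakly increasing columns in \<open>{..d}\<close>, that is, multisets of size
  \<open>t\<close>, so the labels correspond to the sums of \<open>t\<close> of the points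
  \<open>v c\<close>. Products of consecutive variables are the monomials whose columns are all
  equal; they give the vertices of the dilated simplex.

  The geometry rests on one property: the linear map from weights to points is injective on the
  union of the weight polytopes of all staircases at once. A point then knows its weights, whichever
  cell it is regarded in, and inclusions, intersections, faces and vertices become statements about
  finite sets. The part on box complexes therefore needs no coordinates; even dimensions are only
  squeezed between a vertex and the ambient simplex by chains of faces. Sets that miss a row all
  have the empty cell, so statements that recover a set from its cell ask that every row be
  met.\<close>

locale box_frame =
  fixes V :: "'p set" and row :: "'p \<Rightarrow> 'r" and R :: "'r set" and e :: "'p \<Rightarrow> 'a::euclidean_space"
  assumes finite_V: "finite V" and finite_R: "finite R" and R_nonempty: "R \<noteq> {}"
    and row_V: "row ` V \<subseteq> R"
begin

text \<open>The product, over the rows, of the simplices on the points of \<open>B\<close> in each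
  row. Weights are total functions that vanish off \<open>B\<close>, so weights from different cells
  can be compared directly.\<close>

definition weights :: "'p set \<Rightarrow> ('p \<Rightarrow> real) set" where
  "weights B = {\<mu>. (\<forall>p. 0 \<le> \<mu> p) \<and> (\<forall>p. p \<notin> B \<longrightarrow> \<mu> p = 0) \<and>
     (\<forall>k\<in>R. (\<Sum>p | p \<in> V \<and> row p = k. \<mu> p) = 1)}"

definition combo :: "('p \<Rightarrow> real) \<Rightarrow> 'a" where
  "combo \<mu> = (\<Sum>p\<in>V. \<mu> p *\<^sub>R e p)"

definition cell :: "'p set \<Rightarrow> 'a set" where
  "cell B = combo ` weights B"

text \<open>A facet of a product of simplices deletes one vertex of a factor that has at least two;
  these points index the facets of \<open>cell B\<close>.\<close>

definition removable :: "'p set \<Rightarrow> 'p set" where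
  "removable B = {p \<in> B. \<exists>q\<in>B. q \<noteq> p \<and> row q = row p}"

lemma weights_mono: "B \<subseteq> C \<Longrightarrow> weights B \<subseteq> weights C"
  unfolding weights_def by auto

lemma weights_Int: "weights B \<inter> weights C = weights (B \<inter> C)"
  unfolding weights_def by auto

lemma weights_support: "\<mu> \<in> weights B \<Longrightarrow> \<mu> \<in> weights {p. \<mu> p \<noteq> 0}"
  unfolding weights_def by auto

lemma weights_nonneg: "\<mu> \<in> weights B \<Longrightarrow> 0 \<le> \<mu> p"
  unfolding weights_def by auto

lemma weights_zero: "\<mu> \<in> weights B \<Longrightarrow> p \<notin> B \<Longrightarrow> \<mu> p = 0"
  unfolding weights_def by auto

lemma weights_row: "\<mu> \<in> weights B \<Longrightarrow> k \<in> R \<Longrightarrow> (\<Sum>p | p \<in> V \<and> row p = k. \<mu> p) = 1"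
  unfolding weights_def by auto

lemma weights_le_1:
  assumes "\<mu> \<in> weights B" "p \<in> V"
  shows "\<mu> p \<le> 1"
proof -
  have "\<mu> p \<le> (\<Sum>q | q \<in> V \<and> row q = row p. \<mu> q)"
    using assms finite_V weights_nonneg[OF assms(1)] by (intro member_le_sum) auto
  then show ?thesis using assms row_V weights_row by auto
qed

lemma weights_rows:
  assumes "\<mu> \<in> weights B" "k \<in> R"
  obtains p where "p \<in> B" "p \<in> V" "row p = k" "\<mu> p \<noteq> 0"
proof -
  have "(\<Sum>p | p \<in> V \<and> row p = k. \<mu> p) \<noteq> 0" using weights_row[OF assms] by simp
  then obtain p where "p \<in> V" "row p = k" "\<mu> p \<noteq> 0" by (rule sum.not_neutral_contains_not_neutral) auto
  then show ?thesis using that weights_zero[OF assms(1)] by blast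
qed

text \<open>\<open>u\<close> may lie outside the unit interval: \<open>face_of_cell\<close>
  extrapolates with a negative \<open>u\<close>, which is why nonnegativity is a hypothesis.\<close>

lemma weights_affine:
  assumes "\<mu> \<in> weights B" "\<nu> \<in> weights B" "\<And>p. 0 \<le> (1 - u) * \<mu> p + u * \<nu> p"
  shows "(\<lambda>p. (1 - u) * \<mu> p + u * \<nu> p) \<in> weights B"
  using assms
  by (auto simp: weights_def sum.distrib sum_distrib_left[symmetric])

lemma combo_affine:
  "combo (\<lambda>p. a * \<mu> p + b * \<nu> p) = a *\<^sub>R combo \<mu> + b *\<^sub>R combo \<nu>"
  by (simp add: combo_def scaleR_add_left sum.distrib scaleR_sum_right)

lemma convex_cell: "convex (cell B)"
proof (rule convexI)
  fix x y and u v :: real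
  assume "x \<in> cell B" "y \<in> cell B" and uv: "0 \<le> u" "0 \<le> v" "u + v = 1"
  then obtain \<mu> \<nu> where m: "\<mu> \<in> weights B" "x = combo \<mu>" "\<nu> \<in> weights B" "y = combo \<nu>"
    by (auto simp: cell_def)
  have "(\<lambda>p. (1 - v) * \<mu> p + v * \<nu> p) \<in> weights B"
    using m uv by (intro weights_affine) (auto simp: weights_nonneg)
  moreover have "1 - v = u" using uv by simp
  ultimately show "u *\<^sub>R x + v *\<^sub>R y \<in> cell B"
    unfolding cell_def m(2,4) combo_affine[symmetric] by auto
qed

lemma cell_mono: "B \<subseteq> C \<Longrightarrow> cell B \<subseteq> cell C"
  unfolding cell_def using weights_mono by blast

text \<open>Each row is spread uniformly over its points of \<open>B\<close>. The result plays the
  role of a relative interior point and lets an inclusion of cells be tested at a single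
  point.\<close>

lemma positive_weights:
  assumes "B \<subseteq> V" "row ` B = R"
  obtains \<mu> where "\<mu> \<in> weights B" "\<And>p. p \<in> B \<Longrightarrow> 0 < \<mu> p"
proof
  let ?\<mu> = "\<lambda>p. if p \<in> B then 1 / real (card {q \<in> B. row q = row p}) else 0"
  have fin: "finite B" using assms finite_V finite_subset by blast
  have "(\<Sum>p | p \<in> V \<and> row p = k. ?\<mu> p) = 1" if "k \<in> R" for k
  proof -
    have ne: "{q \<in> B. row q = k} \<noteq> {}" using that assms by auto
    have "(\<Sum>p | p \<in> V \<and> row p = k. ?\<mu> p) = (\<Sum>p | p \<in> B \<and> row p = k. ?\<mu> p)"
      using assms finite_V by (intro sum.mono_neutral_right) auto
    also have "\<dots> = (\<Sum>p | p \<in> B \<and> row p = k. 1 / real (card {q \<in> B. row q = k}))"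
      by (intro sum.cong) auto
    also have "\<dots> = 1" using ne fin by auto
    finally show ?thesis .
  qed
  then show "?\<mu> \<in> weights B" by (auto simp: weights_def)
  fix p assume p: "p \<in> B"
  then have "{q \<in> B. row q = row p} \<noteq> {}" by blast
  then show "0 < ?\<mu> p" using p fin by (simp add: card_gt_0_iff)
qed

lemma cell_eq_empty_iff:
  assumes "B \<subseteq> V"
  shows "cell B = {} \<longleftrightarrow> row ` B \<noteq> R"
proof -
  have "R \<subseteq> row ` B" if "\<mu> \<in> weights B" for \<mu>
  proof
    fix k assume "k \<in> R"
    from weights_rows[OF that this] obtain p where "p \<in> B" "row p = k" by metis
    then show "k \<in> row ` B" by blast
  qed
  moreover have "weights B \<noteq> {}" if "row ` B = R"
    by (rule positive_weights[OF assms that]) auto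
  moreover have "row ` B \<subseteq> R" using assms row_V by blast
  ultimately show ?thesis unfolding cell_def by blast
qed

lemma removable_iff:
  assumes "row ` B = R" "p \<in> B"
  shows "p \<in> removable B \<longleftrightarrow> row ` (B - {p}) = R"
proof
  assume "p \<in> removable B"
  then obtain q where "q \<in> B" "q \<noteq> p" "row q = row p" by (auto simp: removable_def)
  then have "row p \<in> row ` (B - {p})" by (metis DiffI image_eqI singletonD)
  then show "row ` (B - {p}) = R" using assms by blast
next
  assume "row ` (B - {p}) = R"
  then have "row p \<in> row ` (B - {p})" using assms by blast
  then show "p \<in> removable B" using assms by (auto simp: removable_def)
qed

lemma removable_mono: "B \<subseteq> C \<Longrightarrow> removable B \<subseteq> removable C"
  by (auto simp: removable_def)

lemma removable_nonempty:
  assumes "B \<subseteq> V" "row ` B = R" "card R < card B"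
  shows "removable B \<noteq> {}"
proof
  assume "removable B = {}"
  then have "inj_on row B" by (fastforce simp: removable_def inj_on_def)
  then show False using card_image[of row B] assms by simp
qed

lemma graph_subset:
  assumes "B \<subseteq> V" "row ` B = R"
  obtains G where "G \<subseteq> B" "row ` G = R" "card G = card R"
proof -
  obtain G where "G \<subseteq> B" "R = row ` G" "inj_on row G"
    using subset_image_inj[of R row B] assms by auto
  then show ?thesis using that card_image by metis
qed

text \<open>A cell is the Minkowski sum over the rows of the hulls of the row points, and hulls
  commute with Minkowski sums. The choice functions \<open>a\<close> later become the monomials of a
  label set, one variable from each factor.\<close>

lemma cell_eq_hull:
  assumes "B \<subseteq> V"
  shows "cell B = convex hull {\<Sum>k\<in>R. e (a k) | a. \<forall>k\<in>R. a k \<in> B \<and> row (a k) = k}"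
    (is "_ = convex hull ?P")
proof
  let ?Y = "\<lambda>k. e ` {p \<in> B. row p = k}"
  have P: "?P = (\<Sum>k\<in>R. ?Y k)"
  proof -
    have "(\<Sum>k\<in>R. ?Y k) = {sum s R | s. \<forall>k\<in>R. s k \<in> ?Y k}"
      using finite_R by (rule set_sum_alt)
    also have "\<dots> = ?P"
    proof (intro equalityI subsetI)
      fix x assume "x \<in> {sum s R | s. \<forall>k\<in>R. s k \<in> ?Y k}"
      then obtain s where s: "x = sum s R" "\<forall>k\<in>R. \<exists>p. p \<in> B \<and> row p = k \<and> s k = e p" by fast
      then obtain a where "\<forall>k\<in>R. a k \<in> B \<and> row (a k) = k \<and> s k = e (a k)" by metis
      then show "x \<in> ?P" using s by (intro CollectI exI[of _ a]) (auto intro: sum.cong)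
    next
      fix x assume "x \<in> ?P"
      then obtain a where "x = (\<Sum>k\<in>R. e (a k))" "\<forall>k\<in>R. a k \<in> B \<and> row (a k) = k" by blast
      then show "x \<in> {sum s R | s. \<forall>k\<in>R. s k \<in> ?Y k}" by auto
    qed
    finally show ?thesis by simp
  qed
  show "cell B \<subseteq> convex hull ?P"
  proof
    fix x assume "x \<in> cell B"
    then obtain \<mu> where \<mu>: "\<mu> \<in> weights B" "x = combo \<mu>" by (auto simp: cell_def)
    let ?s = "\<lambda>k. \<Sum>p | p \<in> V \<and> row p = k. \<mu> p *\<^sub>R e p"
    have "?s k \<in> convex hull ?Y k" if k: "k \<in> R" for k
    proof -
      have eq: "(\<Sum>p | p \<in> V \<and> row p = k. f p) = (\<Sum>p | p \<in> B \<and> row p = k. f p)"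
        if "\<And>p. p \<notin> B \<Longrightarrow> f p = 0" for f :: "'p \<Rightarrow> 'b::comm_monoid_add"
        using assms finite_V that by (intro sum.mono_neutral_right) auto
      have "finite B" using assms finite_V finite_subset by blast
      moreover have "(\<Sum>p | p \<in> B \<and> row p = k. \<mu> p) = 1"
        using weights_row[OF \<mu>(1) k] eq[of \<mu>] weights_zero[OF \<mu>(1)] by simp
      ultimately have "(\<Sum>p | p \<in> B \<and> row p = k. \<mu> p *\<^sub>R e p) \<in> convex hull ?Y k"
        using weights_nonneg[OF \<mu>(1)] by (intro convex_sum) (auto intro: hull_inc)
      then show ?thesis using eq[of "\<lambda>p. \<mu> p *\<^sub>R e p"] weights_zero[OF \<mu>(1)] by simp
    qed
    then have "sum ?s R \<in> (\<Sum>k\<in>R. convex hull ?Y k)"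
      by (subst set_sum_alt[OF finite_R]) blast
    also have "sum ?s R = x"
      unfolding \<mu>(2) combo_def using finite_V finite_R row_V by (rule sum.group)
    finally show "x \<in> convex hull ?P" unfolding P convex_hull_set_sum .
  qed
  show "convex hull ?P \<subseteq> cell B"
  proof (rule hull_minimal)
    show "convex (cell B)" by (rule convex_cell)
    show "?P \<subseteq> cell B"
    proof clarify
      fix a assume a: "\<forall>k\<in>R. a k \<in> B \<and> row (a k) = k"
      let ?\<mu> = "\<lambda>p. if p \<in> a ` R then 1 else 0 :: real"
      have row_a: "{p \<in> V. row p = k} \<inter> a ` R = {a k}" if "k \<in> R" for k
        using a assms that by auto
      have "?\<mu> \<in> weights B"
        using a finite_V
        by (auto simp: weights_def sum.If_cases row_a)
      moreover have "combo ?\<mu> = (\<Sum>k\<in>R. e (a k))"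
      proof -
        have "combo ?\<mu> = (\<Sum>p\<in>V. if p \<in> a ` R then e p else 0)"
          unfolding combo_def by (intro sum.cong) auto
        also have "\<dots> = (\<Sum>p\<in>a ` R. e p)"
          using a assms finite_V by (subst sum.If_cases) (auto intro!: sum.cong)
        also have "\<dots> = (\<Sum>k\<in>R. e (a k))"
          using a by (intro sum.reindex_cong[of a]) (auto intro!: inj_onI, metis)
        finally show ?thesis .
      qed
      ultimately show "(\<Sum>k\<in>R. e (a k)) \<in> cell B" unfolding cell_def by force
    qed
  qed
qed

lemma polytope_cell:
  assumes "B \<subseteq> V"
  shows "polytope (cell B)"
proof -
  let ?P = "{\<Sum>k\<in>R. e (a k) | a. \<forall>k\<in>R. a k \<in> B \<and> row (a k) = k}"
  have "?P \<subseteq> (\<lambda>a. \<Sum>k\<in>R. e (a k)) ` (R \<rightarrow>\<^sub>E V)"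
  proof clarify
    fix a assume "\<forall>k\<in>R. a k \<in> B \<and> row (a k) = k"
    then have "restrict a R \<in> R \<rightarrow>\<^sub>E V" using assms by auto
    moreover have "(\<Sum>k\<in>R. e (a k)) = (\<Sum>k\<in>R. e (restrict a R k))" by simp
    ultimately show "(\<Sum>k\<in>R. e (a k)) \<in> (\<lambda>a. \<Sum>k\<in>R. e (a k)) ` (R \<rightarrow>\<^sub>E V)" by blast
  qed
  then have "finite ?P" using finite_V finite_R by (meson finite_PiE finite_imageI finite_subset)
  then show ?thesis using cell_eq_hull[OF assms] polytope_def by blast
qed

end

section \<open>Faces, intersections and vertices of cells\<close>

text \<open>\<open>inj_combo\<close> asks for injectivity across cells, not just on each of them:
  this is what makes the cells fit together, since a common point of two cells has the same weights
  in both.\<close>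

locale box_complex = box_frame V row R e
  for V :: "'p set" and row :: "'p \<Rightarrow> 'r" and R :: "'r set" and e :: "'p \<Rightarrow> 'a::euclidean_space" +
  fixes \<B> :: "'p set set"
  assumes subset_V: "B \<in> \<B> \<Longrightarrow> B \<subseteq> V"
    and down_closed: "B \<in> \<B> \<Longrightarrow> C \<subseteq> B \<Longrightarrow> C \<in> \<B>"
    and inj_combo: "inj_on combo (\<Union>(weights ` \<B>))"
begin

lemma combo_cancel:
  assumes "\<mu> \<in> weights B" "B \<in> \<B>" "\<nu> \<in> weights C" "C \<in> \<B>" "combo \<mu> = combo \<nu>"
  shows "\<mu> = \<nu>"
  using assms by (intro inj_onD[OF inj_combo]) auto

lemma cell_Int:
  assumes "B \<in> \<B>" "C \<in> \<B>"
  shows "cell B \<inter> cell C = cell (B \<inter> C)"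
proof -
  have "combo ` weights B \<inter> combo ` weights C = combo ` (weights B \<inter> weights C)"
    using assms by (intro inj_on_image_Int[OF inj_combo, symmetric]) auto
  then show ?thesis by (simp add: cell_def weights_Int)
qed

text \<open>Test at a weight that is positive on all of \<open>B\<close>: its point has no other
  weights in \<open>cell C\<close>, so its support lies in \<open>C\<close>. If \<open>B\<close>
  missed a row, \<open>cell B\<close> would be empty.\<close>

lemma cell_subset_iff:
  assumes "B \<in> \<B>" "C \<in> \<B>" "row ` B = R"
  shows "cell B \<subseteq> cell C \<longleftrightarrow> B \<subseteq> C"
proof
  assume sub: "cell B \<subseteq> cell C"
  obtain \<mu> where \<mu>: "\<mu> \<in> weights B" "\<And>p. p \<in> B \<Longrightarrow> 0 < \<mu> p"
    using positive_weights assms subset_V by metis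
  then have "combo \<mu> \<in> cell C" using sub by (auto simp: cell_def)
  then obtain \<nu> where "\<nu> \<in> weights C" "combo \<mu> = combo \<nu>" by (auto simp: cell_def)
  then have "\<mu> \<in> weights C" using combo_cancel \<mu>(1) assms(1,2) by blast
  then show "B \<subseteq> C" using \<mu>(2) weights_zero by force
qed (rule cell_mono)

text \<open>If a combination of two nonnegative weights with positive coefficients vanishes off
  \<open>C\<close>, then both weights vanish off \<open>C\<close>.\<close>

lemma cell_face_of:
  assumes "B \<in> \<B>" "C \<subseteq> B"
  shows "cell C face_of cell B"
  unfolding face_of_def
proof (intro conjI ballI impI)
  show "cell C \<subseteq> cell B" "convex (cell C)" using assms cell_mono convex_cell by auto
  fix x y z assume xyz: "x \<in> cell B" "y \<in> cell B" "z \<in> cell C" "z \<in> open_segment x y"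
  then obtain \<mu> \<nu> \<rho> where m: "\<mu> \<in> weights B" "x = combo \<mu>" "\<nu> \<in> weights B" "y = combo \<nu>"
    "\<rho> \<in> weights C" "z = combo \<rho>"
    by (auto simp: cell_def)
  from xyz obtain u where u: "0 < u" "u < 1" "z = (1 - u) *\<^sub>R x + u *\<^sub>R y"
    by (auto simp: in_segment)
  have "(\<lambda>p. (1 - u) * \<mu> p + u * \<nu> p) \<in> weights B"
    using m u by (intro weights_affine) (auto simp: weights_nonneg)
  moreover have "C \<in> \<B>" using assms down_closed by blast
  ultimately have \<rho>: "\<rho> = (\<lambda>p. (1 - u) * \<mu> p + u * \<nu> p)"
    using m u assms combo_cancel by (metis combo_affine)
  have "\<mu> p = 0 \<and> \<nu> p = 0" if "p \<notin> C" for p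
  proof -
    have "(1 - u) * \<mu> p + u * \<nu> p = 0" using weights_zero[OF m(5) that] \<rho> by metis
    moreover have "0 \<le> (1 - u) * \<mu> p" "0 \<le> u * \<nu> p" using m u by (auto simp: weights_nonneg)
    ultimately have "(1 - u) * \<mu> p = 0" "u * \<nu> p = 0" by linarith+
    then show ?thesis using u by simp
  qed
  then have "\<mu> \<in> weights C" "\<nu> \<in> weights C" using m by (auto simp: weights_def)
  then show "x \<in> cell C" "y \<in> cell C" using m by (auto simp: cell_def)
qed

text \<open>Take weights of a point of the face with the largest possible support. Averaging with
  any other point of the face shows that no support escapes it. Conversely, a point of the cell on
  this support can be joined through the chosen point to a further point of \<open>cell B\<close>,
  and the face property pulls it into the face.\<close>

lemma face_of_cell:
  assumes "B \<in> \<B>" "F face_of cell B"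
  obtains C where "C \<subseteq> B" "F = cell C"
proof (cases "F = {}")
  case True
  then show ?thesis using that[of "{}"] cell_eq_empty_iff[of "{}"] R_nonempty by auto
next
  case False
  define M where "M = {\<mu> \<in> weights B. combo \<mu> \<in> F}"
  let ?supp = "\<lambda>\<mu> :: 'p \<Rightarrow> real. {p. \<mu> p \<noteq> 0}"
  have F: "F \<subseteq> cell B" "convex F" using assms by (auto simp: face_of_def)
  have finB: "finite B" using assms subset_V finite_V finite_subset by metis
  have supp: "?supp \<mu> \<subseteq> B" if "\<mu> \<in> weights B" for \<mu> using that weights_zero by blast
  obtain x where x: "x \<in> F" using False by blast
  then obtain \<mu>\<^sub>0 where "\<mu>\<^sub>0 \<in> weights B" "x = combo \<mu>\<^sub>0" using F(1) by (auto simp: cell_def)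
  then have M0: "\<mu>\<^sub>0 \<in> M" using x by (simp add: M_def)
  have "\<forall>\<mu>. \<mu> \<in> M \<longrightarrow> card (?supp \<mu>) < Suc (card B)"
    using supp finB by (auto simp: M_def less_Suc_eq_le intro: card_mono)
  from ex_has_greatest_nat[of "\<lambda>\<mu>. \<mu> \<in> M", OF M0 this]
  obtain \<mu> where \<mu>M: "\<mu> \<in> M" and max: "\<And>\<nu>. \<nu> \<in> M \<Longrightarrow> card (?supp \<nu>) \<le> card (?supp \<mu>)"
    by auto
  then have \<mu>: "\<mu> \<in> weights B" "combo \<mu> \<in> F" by (auto simp: M_def)
  let ?C = "?supp \<mu>"
  have C: "?C \<subseteq> B" using supp \<mu> by blast
  have "F = cell ?C"
  proof
    show "F \<subseteq> cell ?C"
    proof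
      fix y assume y: "y \<in> F"
      then obtain \<nu> where \<nu>: "\<nu> \<in> weights B" "y = combo \<nu>" using F by (auto simp: cell_def)
      define \<rho> where "\<rho> = (\<lambda>p. (1 - 1/2) * \<mu> p + 1/2 * \<nu> p)"
      have "\<rho> \<in> weights B"
        unfolding \<rho>_def using \<mu> \<nu> by (intro weights_affine) (auto simp: weights_nonneg)
      moreover have "combo \<rho> \<in> F"
        unfolding \<rho>_def combo_affine using F(2) \<mu> \<nu> y by (intro convexD) auto
      ultimately have "\<rho> \<in> M" by (simp add: M_def)
      then have le: "card (?supp \<rho>) \<le> card ?C" by (rule max)
      have \<rho>_eq: "?supp \<rho> = ?C \<union> ?supp \<nu>"
      proof -
        have "\<rho> p = 0 \<longleftrightarrow> \<mu> p = 0 \<and> \<nu> p = 0" for p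
          using weights_nonneg[OF \<mu>(1), of p] weights_nonneg[OF \<nu>(1), of p] by (auto simp: \<rho>_def)
        then show ?thesis by auto
      qed
      have "?C = ?supp \<rho>"
      proof (rule card_seteq)
        show "finite (?supp \<rho>)" using \<open>\<rho> \<in> weights B\<close> supp finB finite_subset by metis
      qed (use le \<rho>_eq in auto)
      then have "?supp \<nu> \<subseteq> ?C" using \<rho>_eq by blast
      then have "\<nu> \<in> weights ?C" using weights_support[OF \<nu>(1)] weights_mono by blast
      then show "y \<in> cell ?C" using \<nu> by (auto simp: cell_def)
    qed
    show "cell ?C \<subseteq> F"
    proof
      fix y assume "y \<in> cell ?C"
      then obtain \<nu> where \<nu>: "\<nu> \<in> weights ?C" "y = combo \<nu>" by (auto simp: cell_def)
      \<comment> \<open>The least positive coordinate of \<open>\<mu>\<close>. As the entries of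
        \<open>\<nu>\<close> on the support are at most 1, moving from \<open>\<mu>\<close> away
        from \<open>\<nu>\<close> by this factor keeps all coordinates nonnegative.\<close>
      define \<epsilon> where "\<epsilon> = Min (\<mu> ` ?C)"
      have finC: "finite ?C" using C finB finite_subset by blast
      moreover have neC: "?C \<noteq> {}"
      proof -
        obtain k where "k \<in> R" using R_nonempty by blast
        then obtain p where "\<mu> p \<noteq> 0" using weights_rows[OF \<mu>(1)] by metis
        then show ?thesis by blast
      qed
      ultimately have "\<epsilon> \<in> \<mu> ` ?C" unfolding \<epsilon>_def by (intro Min_in) auto
      then have \<epsilon>: "0 < \<epsilon>" using weights_nonneg[OF \<mu>(1)] by (force simp: less_le)
      have \<nu>B: "\<nu> \<in> weights B" using \<nu> C weights_mono by blast
      define \<rho> where "\<rho> = (\<lambda>p. (1 - (- \<epsilon>)) * \<mu> p + (- \<epsilon>) * \<nu> p)"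
      have "0 \<le> (1 - (- \<epsilon>)) * \<mu> p + (- \<epsilon>) * \<nu> p" for p
      proof (cases "p \<in> ?C")
        case True
        then have "\<epsilon> \<le> \<mu> p" unfolding \<epsilon>_def using finC by (intro Min_le) auto
        moreover have "\<epsilon> * \<nu> p \<le> \<epsilon> * 1"
          using \<epsilon> True C assms subset_V by (intro mult_left_mono weights_le_1[OF \<nu>(1)]) auto
        moreover have "0 \<le> \<epsilon> * \<mu> p" using \<epsilon> weights_nonneg[OF \<mu>(1)] by simp
        ultimately show ?thesis by (simp add: algebra_simps)
      next
        case False
        then show ?thesis using weights_zero[OF \<nu>(1)] by simp
      qed
      then have \<rho>: "\<rho> \<in> weights B"
        unfolding \<rho>_def using \<mu>(1) \<nu>B by (intro weights_affine)
      have z: "combo \<rho> = (1 + \<epsilon>) *\<^sub>R combo \<mu> - \<epsilon> *\<^sub>R y"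
        unfolding \<rho>_def combo_affine \<nu> by simp
      \<comment> \<open>The parameter at which the segment from \<open>y\<close> to the extrapolated
        point \<open>combo \<rho>\<close> passes through \<open>combo \<mu>\<close>.\<close>
      define w where "w = 1 / (1 + \<epsilon>)"
      have w: "0 < w" "w < 1" "1 - w - w * \<epsilon> = 0" "w * (1 + \<epsilon>) = 1"
        using \<epsilon> by (auto simp: w_def field_simps)
      have "(1 - w) *\<^sub>R y + w *\<^sub>R combo \<rho> = (1 - w - w * \<epsilon>) *\<^sub>R y + (w * (1 + \<epsilon>)) *\<^sub>R combo \<mu>"
        unfolding z by (simp add: scaleR_diff_right scaleR_diff_left)
      then have "combo \<mu> = (1 - w) *\<^sub>R y + w *\<^sub>R combo \<rho>" unfolding w(3,4) by simp
      then have seg: "y \<noteq> combo \<rho> \<Longrightarrow> combo \<mu> \<in> open_segment y (combo \<rho>)"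
        using w(1,2) unfolding in_segment by blast
      have mem: "y \<in> cell B" "combo \<rho> \<in> cell B" using \<nu> \<nu>B \<rho> by (auto simp: cell_def)
      show "y \<in> F"
      proof (cases "y = combo \<rho>")
        case True
        then have "(1 + \<epsilon>) *\<^sub>R y = (1 + \<epsilon>) *\<^sub>R combo \<mu>" using z by (simp add: algebra_simps)
        then show ?thesis using \<epsilon> \<mu>(2) by simp
      next
        case False
        then show ?thesis using seg mem assms(2) \<mu>(2) unfolding face_of_def by blast
      qed
    qed
  qed
  then show ?thesis using that C by blast
qed

lemma polytopal_complex_cells: "polytopal_complex (cell ` \<B>)"
proof -
  have "\<B> \<subseteq> Pow V" using subset_V by blast
  then have "finite (cell ` \<B>)" using finite_V by (meson finite_Pow_iff finite_imageI finite_subset)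
  moreover have "F \<in> cell ` \<B>" if "B \<in> \<B>" "F face_of cell B" for B F
    by (rule face_of_cell[OF that]) (use down_closed[OF that(1)] in blast)
  moreover have "cell B \<inter> cell C face_of cell B \<and> cell B \<inter> cell C face_of cell C"
    if "B \<in> \<B>" "C \<in> \<B>" for B C
    using cell_face_of[OF that(1), of "B \<inter> C"] cell_face_of[OF that(2), of "B \<inter> C"]
    unfolding cell_Int[OF that] by blast
  moreover have "\<forall>P\<in>cell ` \<B>. polytope P" using polytope_cell subset_V by blast
  ultimately show ?thesis unfolding polytopal_complex_def by blast
qed

text \<open>One point from each row of \<open>B\<close> already gives a nonempty subcell; if the
  cell is a point, the two cells agree and hence so do the supports. Conversely, the only point of a
  row must carry weight 1.\<close>

lemma singleton_cell_iff:
  assumes "B \<in> \<B>" "row ` B = R" "x \<in> cell B"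
  shows "cell B = {x} \<longleftrightarrow> inj_on row B"
proof
  assume x: "cell B = {x}"
  obtain G where G: "G \<subseteq> B" "R = row ` G" "inj_on row G"
    using subset_image_inj[of R row B] assms by auto
  then have "cell G \<noteq> {}" "cell G \<subseteq> cell B"
    using cell_eq_empty_iff[of G] subset_V assms(1) cell_mono by auto
  then have "cell B \<subseteq> cell G" using x by auto
  then have "B \<subseteq> G" using cell_subset_iff assms(1,2) down_closed G by metis
  then show "inj_on row B" using G by (metis inj_on_subset)
next
  assume inj: "inj_on row B"
  have "\<mu> = \<nu>" if "\<mu> \<in> weights B" "\<nu> \<in> weights B" for \<mu> \<nu>
  proof
    fix p
    show "\<mu> p = \<nu> p"
    proof (cases "p \<in> B")
      case True
      have "\<rho> p = 1" if \<rho>: "\<rho> \<in> weights B" for \<rho>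
      proof -
        have pV: "p \<in> V" using True assms subset_V by blast
        then have "(\<Sum>q | q \<in> V \<and> row q = row p. \<rho> q) = (\<Sum>q\<in>{p}. \<rho> q)"
          using finite_V True inj weights_zero[OF \<rho>]
          by (intro sum.mono_neutral_right) (auto simp: inj_on_def)
        then show ?thesis using weights_row[OF \<rho>, of "row p"] pV row_V by auto
      qed
      from this[OF that(1)] this[OF that(2)] show ?thesis by simp
    qed (use that weights_zero in metis)
  qed
  then show "cell B = {x}" using assms(3) by (force simp: cell_def)
qed

text \<open>The vertices are among the generators of the hull. Conversely, the graph of a choice has
  a one-point cell, and it is a face because every subset of \<open>B\<close> gives a face.\<close>

lemma extreme_points_cell:
  assumes "B \<in> \<B>"
  shows "{x. x extreme_point_of cell B} =
    {\<Sum>k\<in>R. e (a k) | a. \<forall>k\<in>R. a k \<in> B \<and> row (a k) = k}" (is "_ = ?P")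
proof (intro equalityI subsetI)
  fix x assume "x \<in> {x. x extreme_point_of cell B}"
  then show "x \<in> ?P"
    using extreme_point_of_convex_hull cell_eq_hull[OF subset_V[OF assms]] by auto
next
  fix x assume "x \<in> ?P"
  then obtain a where a: "x = (\<Sum>k\<in>R. e (a k))" "\<forall>k\<in>R. a k \<in> B \<and> row (a k) = k" by blast
  let ?G = "a ` R"
  have G: "?G \<subseteq> B" "row ` ?G = R" "inj_on row ?G" using a by (auto simp: inj_on_def image_image)
  have "x \<in> convex hull {\<Sum>k\<in>R. e (b k) | b. \<forall>k\<in>R. b k \<in> ?G \<and> row (b k) = k}"
    using a by (intro hull_inc) blast
  then have "x \<in> cell ?G" using cell_eq_hull[of ?G] G subset_V[OF assms] by auto
  then have "cell ?G = {x}" using singleton_cell_iff[of ?G x] G down_closed[OF assms] by auto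
  then have "{x} face_of cell B" using cell_face_of[OF assms G(1)] by simp
  then show "x \<in> {x. x extreme_point_of cell B}" by (simp add: face_of_singleton)
qed

end

section \<open>Dimensions of cells and shellings of their boundaries\<close>

text \<open>The prescribed last element lies outside the initial segment \<open>S\<close> unless
  \<open>S\<close> is everything, so the requirements on the list do not collide.\<close>

lemma obtain_ordering:
  assumes "finite L" "S \<subseteq> L" "s \<in> S" "b \<in> L" "s \<noteq> b" "b \<in> S \<Longrightarrow> S = L"
  obtains xs where "distinct xs" "set xs = L" "set (take (card S) xs) = S" "hd xs = s" "last xs = b"
proof (cases "b \<in> S")
  case True
  obtain ys where ys: "set ys = L - {s, b}" "distinct ys"
    using finite_distinct_list[of "L - {s, b}"] assms(1) by auto
  let ?xs = "s # ys @ [b]"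
  have d: "distinct ?xs" "set ?xs = L" using ys assms by auto
  moreover have "card S = length ?xs" using assms(6)[OF True] distinct_card[OF d(1)] d(2) by simp
  ultimately show ?thesis using that[of ?xs] assms(6)[OF True] by simp
next
  case False
  have fin: "finite S" using assms finite_subset by blast
  obtain ys where ys: "set ys = S - {s}" "distinct ys"
    using finite_distinct_list[of "S - {s}"] fin by auto
  obtain zs where zs: "set zs = L - S - {b}" "distinct zs"
    using finite_distinct_list[of "L - S - {b}"] assms(1) by auto
  let ?xs = "s # ys @ zs @ [b]"
  have "length ys = card S - 1" using distinct_card[OF ys(2)] ys(1) assms fin by simp
  moreover have "card S \<noteq> 0" using assms fin by auto
  ultimately have "card S = length (s # ys)" by simp
  then have "take (card S) ?xs = s # ys" by simp
  moreover have "distinct ?xs" "set ?xs = L" using ys zs assms False by auto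
  ultimately show ?thesis using that[of ?xs] ys assms by auto
qed

context box_complex
begin

text \<open>Adding the points of \<open>C\<close> to \<open>B\<close> one at a time passes through
  strictly growing faces, so each step raises the dimension by at least one.\<close>

lemma aff_dim_cell_chain:
  assumes "C \<in> \<B>" "B \<subseteq> C" "row ` B = R"
  shows "aff_dim (cell B) + int (card C) \<le> aff_dim (cell C) + int (card B)"
  using assms(2,3)
proof (induction "card (C - B)" arbitrary: B)
  case 0
  have "finite C" using assms subset_V finite_V finite_subset by metis
  then have "C = B" using 0 by auto
  then show ?case by simp
next
  case (Suc n)
  have fin: "finite C" using assms subset_V finite_V finite_subset by metis
  then have finB: "finite B" using Suc finite_subset by blast
  obtain p where p: "p \<in> C" "p \<notin> B" using Suc(2) by (metis DiffE card.empty equals0I nat.distinct(1))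
  let ?B = "insert p B"
  have "row p \<in> R" using p assms(1) subset_V row_V by blast
  then have B: "?B \<in> \<B>" "?B \<subseteq> C" "row ` ?B = R"
    using p Suc(3,4) down_closed[OF assms(1), of ?B] by auto
  have "n = card (C - ?B)" using Suc(2) card_Diff_insert[OF p] by simp
  then have IH: "aff_dim (cell ?B) + int (card C) \<le> aff_dim (cell C) + int (card ?B)"
    using Suc(1) B by blast
  have "\<not> cell ?B \<subseteq> cell B"
    using cell_subset_iff[of ?B B] B down_closed[OF B(1), of B] p by auto
  then have "aff_dim (cell B) < aff_dim (cell ?B)"
    using face_of_aff_dim_lt[OF convex_cell cell_face_of[OF B(1)], of B] by blast
  then show ?case using IH p finB by simp
qed

lemma boundary_complex_cell:
  assumes "B \<in> \<B>" "row ` B = R"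
  shows "boundary_complex (cell B) = cell ` {C. C \<subset> B}"
proof (intro equalityI subsetI)
  fix F assume F: "F \<in> boundary_complex (cell B)"
  then have "F face_of cell B" by (simp add: boundary_complex_def)
  then obtain C where "C \<subseteq> B" "F = cell C" by (rule face_of_cell[OF assms(1)])
  then show "F \<in> cell ` {C. C \<subset> B}" using F by (auto simp: boundary_complex_def)
next
  fix F assume "F \<in> cell ` {C. C \<subset> B}"
  then obtain C where C: "C \<subset> B" "F = cell C" by blast
  then have "C \<in> \<B>" using assms down_closed by blast
  then have "F \<noteq> cell B" using cell_subset_iff[OF assms(1) _ assms(2), of C] C by blast
  then show "F \<in> boundary_complex (cell B)"
    using C cell_face_of[OF assms(1), of C] by (auto simp: boundary_complex_def)
qed

text \<open>A proper subset that still meets all rows omits a removable point. The bound on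
  \<open>card B\<close> excludes one-point cells, whose only proper face is empty and does not arise
  by deleting a removable point.\<close>

lemma facets_boundary_complex_cell:
  assumes "B \<in> \<B>" "row ` B = R" "card R < card B"
  shows "facets (boundary_complex (cell B)) = (\<lambda>p. cell (B - {p})) ` removable B"
proof (intro equalityI subsetI)
  have step: "cell (B - {p}) \<in> boundary_complex (cell B)" if "p \<in> removable B" for p
    using that boundary_complex_cell[OF assms(1,2)] by (auto simp: removable_def)
  {
    fix P assume P: "P \<in> facets (boundary_complex (cell B))"
    then obtain C where C: "C \<subset> B" "P = cell C"
      using boundary_complex_cell[OF assms(1,2)] by (auto simp: facets_def)
    have CV: "C \<subseteq> V" using C assms subset_V by blast
    have "\<exists>p\<in>removable B. cell C \<subseteq> cell (B - {p})"
    proof (cases "row ` C = R")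
      case True
      obtain p where p: "p \<in> B" "p \<notin> C" using C by blast
      have "R \<subseteq> row ` (B - {p})" using p C True by blast
      then have "p \<in> removable B" using removable_iff[of B p] p assms by blast
      then show ?thesis using p C by (intro bexI[of _ p] cell_mono) auto
    next
      case False
      then have "cell C = {}" using cell_eq_empty_iff[OF CV] by simp
      then show ?thesis
        using removable_nonempty[OF subset_V[OF assms(1)] assms(2,3)] by auto
    qed
    then obtain p where p: "p \<in> removable B" "cell C \<subseteq> cell (B - {p})" by blast
    then have "cell C = cell (B - {p})"
      using P C(2) step[OF p(1)] unfolding facets_def by blast
    then show "P \<in> (\<lambda>p. cell (B - {p})) ` removable B" using p(1) C(2) by blast
  }
  fix P assume "P \<in> (\<lambda>p. cell (B - {p})) ` removable B"
  then obtain p where p: "p \<in> removable B" "P = cell (B - {p})" by blast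
  then have pB: "p \<in> B" by (auto simp: removable_def)
  have "cell (B - {p}) = Q" if Q: "Q \<in> boundary_complex (cell B)" "cell (B - {p}) \<subseteq> Q" for Q
  proof -
    obtain C where C: "C \<subset> B" "Q = cell C" using Q boundary_complex_cell[OF assms(1,2)] by auto
    have "B - {p} \<in> \<B>" "C \<in> \<B>" using C down_closed[OF assms(1)] by auto
    moreover have "row ` (B - {p}) = R" using removable_iff[OF assms(2) pB] p by simp
    ultimately have "B - {p} \<subseteq> C" using cell_subset_iff Q C by metis
    then have "C = B - {p}" using C by blast
    then show ?thesis using C by simp
  qed
  then show "P \<in> facets (boundary_complex (cell B))" using step p by (auto simp: facets_def)
qed

lemma inj_on_cell_remove:
  assumes "B \<in> \<B>" "row ` B = R"
  shows "inj_on (\<lambda>p. cell (B - {p})) (removable B)"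
proof (rule inj_onI)
  fix p q assume pq: "p \<in> removable B" "q \<in> removable B" "cell (B - {p}) = cell (B - {q})"
  then have B: "p \<in> B" "q \<in> B" by (auto simp: removable_def)
  have "B - {p} \<in> \<B>" "B - {q} \<in> \<B>" using down_closed[OF assms(1)] by auto
  moreover have "row ` (B - {p}) = R" using removable_iff[OF assms(2) B(1)] pq by simp
  ultimately have "B - {p} \<subseteq> B - {q}" using cell_subset_iff pq(3) by blast
  then show "p = q" using B by blast
qed

end

locale pure_box_complex = box_complex V row R e \<B>
  for V :: "'p set" and row :: "'p \<Rightarrow> 'r" and R :: "'r set" and e :: "'p \<Rightarrow> 'a::euclidean_space"
    and \<B> :: "'p set set" +
  fixes d :: nat
  assumes extend: "B \<in> \<B> \<Longrightarrow> row ` B = R \<Longrightarrow> \<exists>C\<in>\<B>. B \<subseteq> C \<and> card C = card R + d"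
    and aff_dim_le: "B \<in> \<B> \<Longrightarrow> aff_dim (cell B) \<le> int d"
begin

text \<open>A chain of faces from a one-point cell up to \<open>B\<close> bounds the dimension from
  below; a chain from \<open>B\<close> to a box of full size, of dimension at most \<open>d\<close>,
  bounds it from above.\<close>

lemma aff_dim_cell:
  assumes "B \<in> \<B>" "row ` B = R"
  shows "aff_dim (cell B) = int (card B) - int (card R)"
proof (rule antisym)
  obtain C where "C \<in> \<B>" "B \<subseteq> C" "card C = card R + d" using extend assms by blast
  then show "aff_dim (cell B) \<le> int (card B) - int (card R)"
    using aff_dim_cell_chain[of C B] aff_dim_le[of C] assms by simp
  obtain G where G: "G \<subseteq> B" "row ` G = R" "card G = card R"
    using graph_subset assms subset_V by metis
  then have "cell G \<noteq> {}" using cell_eq_empty_iff[of G] subset_V[OF assms(1)] by blast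
  then have "0 \<le> aff_dim (cell G)" using aff_dim_negative_iff[of "cell G"] by linarith
  then show "int (card B) - int (card R) \<le> aff_dim (cell B)"
    using aff_dim_cell_chain[OF assms(1) G(1,2)] G by simp
qed

text \<open>The facets in \<open>S\<close> form an initial segment of a shelling of the boundary of a product of
  simplices unless they are the union of the boundaries of some, but not all, of the factors. Any
  order that begins and ends with two facets opposite to vertices of one factor is a shelling.\<close>

lemma boundary_shelling:
  assumes "B \<in> \<B>" "row ` B = R" "card B = card R + Suc k" "S \<subseteq> removable B"
    and "S = removable B \<or> (\<exists>s\<in>S. \<exists>b\<in>removable B - S. row s = row b)"
  shows "\<exists>ps. distinct ps \<and> set ps = removable B \<and> set (take (card S) ps) = S \<and>
    shelling k (boundary_complex (cell B)) (map (\<lambda>p. cell (B - {p})) ps)"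
  using assms
proof (induction k arbitrary: B S)
  have order: "\<exists>ps s b. distinct ps \<and> set ps = removable B \<and> set (take (card S) ps) = S \<and>
      hd ps = s \<and> last ps = b \<and> s \<noteq> b \<and> row s = row b"
    and pure: "pure_complex k (boundary_complex (cell B))"
    and facets: "facets (boundary_complex (cell B)) = (\<lambda>p. cell (B - {p})) ` removable B"
    and inj: "inj_on (\<lambda>p. cell (B - {p})) (removable B)"
    if B: "B \<in> \<B>" "row ` B = R" "card B = card R + Suc k" and S: "S \<subseteq> removable B"
      "S = removable B \<or> (\<exists>s\<in>S. \<exists>b\<in>removable B - S. row s = row b)" for k B S
  proof -
    have BV: "B \<subseteq> V" "finite B" using B subset_V finite_V finite_subset by metis+
    then have fin: "finite (removable B)" by (simp add: removable_def)
    have "removable B \<noteq> {}" using B BV by (intro removable_nonempty) auto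
    then obtain p where p: "p \<in> removable B" by blast
    then obtain q where q: "q \<in> B" "q \<noteq> p" "row q = row p" by (auto simp: removable_def)
    then have pq: "q \<in> removable B" using p by (auto simp: removable_def)
    \<comment> \<open>If \<open>S\<close> is all of \<open>removable B\<close>, any two points of a
      common row serve as the two ends of the order.\<close>
    then obtain s b where sb: "s \<in> S" "b \<in> removable B" "s \<noteq> b" "row s = row b"
      "b \<in> S \<Longrightarrow> S = removable B"
      using S p q pq by (metis DiffE)
    obtain ps where "distinct ps" "set ps = removable B" "set (take (card S) ps) = S"
      "hd ps = s" "last ps = b"
      using obtain_ordering[OF fin S(1) sb(1,2,3,5)] by metis
    then show "\<exists>ps s b. distinct ps \<and> set ps = removable B \<and> set (take (card S) ps) = S \<and>
      hd ps = s \<and> last ps = b \<and> s \<noteq> b \<and> row s = row b"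
      using sb by blast
    show facets: "facets (boundary_complex (cell B)) = (\<lambda>p. cell (B - {p})) ` removable B"
      using B by (intro facets_boundary_complex_cell) auto
    have "aff_dim (cell (B - {p})) = int k" if p: "p \<in> removable B" for p
    proof -
      have pB: "p \<in> B" using p by (simp add: removable_def)
      have "aff_dim (cell (B - {p})) = int (card (B - {p})) - int (card R)"
        using p removable_iff[OF B(2) pB] down_closed[OF B(1)] by (intro aff_dim_cell) auto
      also have "card (B - {p}) = card R + k" using pB B BV by simp
      finally show ?thesis by simp
    qed
    then show "pure_complex k (boundary_complex (cell B))"
      by (auto simp: pure_complex_def facets)
    show "inj_on (\<lambda>p. cell (B - {p})) (removable B)" using B by (rule_tac inj_on_cell_remove)
  qed
  {
    case (0 B S)
    then show ?case
      using order[OF 0] pure[OF 0] facets[OF 0] inj[OF 0] by (auto simp: distinct_map)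
  next
    case (Suc k B S)
    note B = Suc.prems(1-3)
    obtain ps s b where ps: "distinct ps" "set ps = removable B" "set (take (card S) ps) = S"
      "hd ps = s" "last ps = b" "s \<noteq> b" "row s = row b"
      using order[OF Suc.prems] by blast
    have finB: "finite B" using B subset_V finite_V finite_subset by metis
    have "ps \<noteq> []" using removable_nonempty[of B] B subset_V ps by auto
    then have sb: "s \<in> removable B" "b \<in> removable B" using ps hd_in_set last_in_set by metis+
    let ?F = "\<lambda>p. cell (B - {p})"
    have remove: "B - {q} \<in> \<B>" "row ` (B - {q}) = R" "card (B - {q}) = card R + Suc k"
      if "q \<in> removable B" for q
      using that removable_iff[OF B(2), of q] down_closed[OF B(1)] B(3) finB
      by (auto simp: removable_def)
    have first: "\<exists>Gs. shelling k (boundary_complex (hd (map ?F ps))) Gs"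
    proof -
      have "hd (map ?F ps) = ?F s" using ps \<open>ps \<noteq> []\<close> by (simp add: hd_map)
      then show ?thesis using Suc.IH[OF remove[OF sb(1)] order.refl] by auto
    qed
    have later: "\<exists>Gs r. shelling k (boundary_complex (map ?F ps ! j)) Gs \<and> 1 \<le> r \<and> r \<le> length Gs \<and>
        map ?F ps ! j \<inter> \<Union>(set (take j (map ?F ps))) = \<Union>(set (take r Gs))"
      if j: "0 < j" "j < length (map ?F ps)" for j
    proof -
      define q Q where "q = ps ! j" and "Q = set (take j ps)"
      have jl: "j < length ps" using j by simp
      have q: "q \<in> removable B" using jl ps(2) q_def nth_mem by blast
      have Q: "Q \<subseteq> removable B" using ps(2) set_take_subset Q_def by fast
      have ps_split: "ps = take j ps @ q # drop (Suc j) ps"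
        using jl by (simp add: q_def id_take_nth_drop[symmetric])
      then have "distinct (take j ps @ q # drop (Suc j) ps)" using ps(1) by metis
      then have qQ: "q \<notin> Q" and dj: "Q \<inter> set (drop (Suc j) ps) = {}" by (auto simp: Q_def)
      have sQ: "s \<in> Q"
      proof -
        have "hd (take j ps) = s" using j ps(4) by simp
        moreover have "take j ps \<noteq> []" using j by auto
        ultimately show ?thesis unfolding Q_def using hd_in_set by metis
      qed
      have bQ: "b \<notin> Q" if "q \<noteq> b"
      proof -
        have "drop (Suc j) ps \<noteq> []" using ps(5) ps_split that by (metis last_snoc)
        then have "b \<in> set (drop (Suc j) ps)" using ps(5) by (metis last_drop last_in_set drop_eq_Nil not_le)
        then show ?thesis using dj by blast
      qed
      have Qb: "Q = removable B - {b}" if "q = b"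
      proof -
        have "drop (Suc j) ps = []"
        proof (rule ccontr)
          assume ne: "drop (Suc j) ps \<noteq> []"
          then have "b \<in> set (drop (Suc j) ps)" using ps(5) by (metis last_drop last_in_set drop_eq_Nil not_le)
          then show False using \<open>distinct (take j ps @ q # drop (Suc j) ps)\<close> that by auto
        qed
        then have "set ps = insert q Q" using ps_split Q_def
            by (metis list.set(2) set_append Un_insert_right list.set(1) sup_bot.right_neutral)
        then show ?thesis using that qQ ps(2) by auto
      qed
      let ?C = "B - {q}"
      let ?T = "Q \<inter> removable ?C"
      have rem: "removable ?C \<subseteq> removable B - {q}"
        using removable_mono[of ?C B] by (auto simp: removable_def)
      \<comment> \<open>The facet \<open>cell ?C\<close> is again a product of simplices, and
        \<open>?T\<close> indexes the part of its boundary covered by earlier facets. The induction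
        hypothesis applies once \<open>?T\<close> is everything or splits some row.\<close>
      have T: "?T = removable ?C \<or> (\<exists>s\<in>?T. \<exists>b\<in>removable ?C - ?T. row s = row b)" "?T \<noteq> {}"
      proof -
        have "?T = removable ?C \<and> ?T \<noteq> {} \<or> (\<exists>s\<in>?T. \<exists>b\<in>removable ?C - ?T. row s = row b)"
        proof (cases "q = b")
          case True
          \<comment> \<open>The last facet has all the others before it.\<close>
          then have "?T = removable ?C" using rem Qb by blast
          then show ?thesis using removable_nonempty[of ?C] remove[OF q] subset_V by auto
        next
          case False
          \<comment> \<open>For any other facet, \<open>s\<close> comes before it and
            \<open>b\<close> after it. Both survive in \<open>?C\<close> and share a row, so
            \<open>?T\<close> contains one and not the other.\<close>
          have "q \<noteq> s" using qQ sQ by blast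
          moreover have "s \<in> B" "b \<in> B" using sb by (simp_all add: removable_def)
          ultimately have "s \<in> ?C" "b \<in> ?C" using False by auto
          then have "s \<in> removable ?C" "b \<in> removable ?C"
            using ps(6,7) unfolding removable_def
            by (intro CollectI conjI bexI[of _ b] bexI[of _ s]; simp)+
          then show ?thesis using sQ bQ[OF False] ps(7) by blast
        qed
        then show "?T = removable ?C \<or> (\<exists>s\<in>?T. \<exists>b\<in>removable ?C - ?T. row s = row b)" "?T \<noteq> {}"
          by blast+
      qed
      obtain qs where qs: "distinct qs" "set qs = removable ?C" "set (take (card ?T) qs) = ?T"
        "shelling k (boundary_complex (cell ?C)) (map (\<lambda>p. cell (?C - {p})) qs)"
        using Suc.IH[OF remove[OF q], of ?T] T(1) by blast
      have finT: "finite ?T" unfolding Q_def by simp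
      have "card ?T \<le> card (set qs)" using qs(2) by (intro card_mono[OF finite_set]) auto
      then have "card ?T \<le> length qs" using qs(1) by (simp add: distinct_card)
      moreover have "1 \<le> card ?T" using T(2) finT by (simp add: Suc_le_eq card_gt_0_iff)
      moreover have "?F q \<inter> \<Union>(set (take j (map ?F ps))) = (\<Union>p\<in>?T. cell (?C - {p}))"
      proof -
        have "?F q \<inter> ?F p = cell (?C - {p})" if "p \<in> Q" for p
        proof -
          have "?C \<inter> (B - {p}) = ?C - {p}" by blast
          then show ?thesis using cell_Int[of ?C "B - {p}"] down_closed[OF B(1)] by auto
        qed
        \<comment> \<open>Here \<open>p\<close> and \<open>q\<close> are the two vertices of a
          one-dimensional factor, and the facets opposite to them are disjoint.\<close>
        moreover have "cell (?C - {p}) = {}" if p: "p \<in> Q" "p \<notin> removable ?C" for p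
        proof -
          have "p \<in> ?C" using p Q qQ by (auto simp: removable_def)
          then show ?thesis
            using removable_iff[OF remove(2)[OF q], of p] p cell_eq_empty_iff[of "?C - {p}"]
              subset_V[OF B(1)] by blast
        qed
        ultimately have "?F q \<inter> (\<Union>p\<in>Q. ?F p) = (\<Union>p\<in>?T. cell (?C - {p}))" by blast
        then show ?thesis by (simp add: take_map Q_def)
      qed
      moreover have "\<Union>(set (take (card ?T) (map (\<lambda>p. cell (?C - {p})) qs))) =
          (\<Union>p\<in>?T. cell (?C - {p}))"
        using qs(3) by (simp add: take_map)
      ultimately show ?thesis
        using qs(4) jl q_def
        by (intro exI[of _ "map (\<lambda>p. cell (?C - {p})) qs"] exI[of _ "card ?T"]) simp
    qed
    show ?case
      using ps first later pure[OF Suc.prems] facets[OF Suc.prems] inj[OF Suc.prems]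
      by (intro exI[of _ ps]) (simp add: distinct_map)
  }
qed

section \<open>Shelling a pure complex of boxes\<close>

definition maximal_boxes :: "'p set set" where
  "maximal_boxes = {B \<in> \<B>. row ` B = R \<and> card B = card R + d}"

text \<open>A set missing a row does not extend, but its empty cell lies in any cell, so it is
  enough that some full-size box exists. Dimension keeps a full-size box from being properly
  contained in another set of the complex.\<close>

lemma facets_cells:
  assumes "maximal_boxes \<noteq> {}"
  shows "facets (cell ` \<B>) = cell ` maximal_boxes"
proof (intro equalityI subsetI)
  fix P assume P: "P \<in> facets (cell ` \<B>)"
  then obtain B where B: "B \<in> \<B>" "P = cell B" by (auto simp: facets_def)
  have "\<exists>C\<in>maximal_boxes. cell B \<subseteq> cell C"
  proof (cases "row ` B = R")
    case True
    then obtain C where C: "C \<in> \<B>" "B \<subseteq> C" "card C = card R + d" using extend B by blast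
    then have "row ` C = R" using True row_V subset_V by blast
    then show ?thesis using C cell_mono[of B C] unfolding maximal_boxes_def by blast
  next
    case False
    then show ?thesis using assms cell_eq_empty_iff[OF subset_V[OF B(1)]] by auto
  qed
  then obtain C where C: "C \<in> maximal_boxes" "cell B \<subseteq> cell C" by blast
  then have "cell C \<in> cell ` \<B>" by (simp add: maximal_boxes_def)
  then have "cell B = cell C" using P B C(2) unfolding facets_def by blast
  then show "P \<in> cell ` maximal_boxes" using B C(1) by blast
next
  fix P assume "P \<in> cell ` maximal_boxes"
  then obtain B where B: "B \<in> \<B>" "row ` B = R" "card B = card R + d" "P = cell B"
    by (auto simp: maximal_boxes_def)
  have "B = C" if C: "C \<in> \<B>" "cell B \<subseteq> cell C" for C
  proof (rule card_seteq)
    show sub: "B \<subseteq> C" using cell_subset_iff C B by blast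
    then have "row ` C = R" using B(2) row_V subset_V[OF C(1)] by blast
    then have "aff_dim (cell C) = int (card C) - int (card R)" using aff_dim_cell C by blast
    then show "card C \<le> card B" using aff_dim_le[OF C(1)] B(3) by simp
    show "finite C" using subset_V[OF C(1)] finite_V finite_subset by blast
  qed
  then show "P \<in> facets (cell ` \<B>)" using B by (auto simp: facets_def)
qed

text \<open>\<open>D B\<close> indexes the facets in which \<open>cell B\<close> meets the earlier
  cells: \<open>D_lower\<close> puts each of them into an earlier cell, \<open>D_separates\<close>
  puts every nonempty intersection into one of them, and \<open>D_good\<close> makes them an initial
  segment of a boundary shelling. Ties in \<open>\<sigma>\<close> are broken arbitrarily, so
  separation is asked for \<open>\<sigma> C \<le> \<sigma> B\<close> but the covering cell must be
  strictly lower. \<open>D_nonempty\<close> is separate because the earlier cells might all be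
  disjoint from \<open>cell B\<close>.\<close>

lemma shellable_cells:
  fixes \<sigma> :: "'p set \<Rightarrow> nat" and D :: "'p set \<Rightarrow> 'p set"
  assumes ne: "maximal_boxes \<noteq> {}"
    and D_removable: "\<And>B. B \<in> maximal_boxes \<Longrightarrow> D B \<subseteq> removable B"
    and D_good: "\<And>B p. B \<in> maximal_boxes \<Longrightarrow> p \<in> D B \<Longrightarrow> \<exists>q\<in>removable B - D B. row p = row q"
    and D_lower: "\<And>B p. B \<in> maximal_boxes \<Longrightarrow> p \<in> D B \<Longrightarrow>
      \<exists>C\<in>maximal_boxes. B - {p} \<subseteq> C \<and> \<sigma> C < \<sigma> B"
    and D_separates: "\<And>B C. B \<in> maximal_boxes \<Longrightarrow> C \<in> maximal_boxes \<Longrightarrow> C \<noteq> B \<Longrightarrow> \<sigma> C \<le> \<sigma> B \<Longrightarrow>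
      row ` (B \<inter> C) = R \<Longrightarrow> \<exists>p\<in>D B. p \<notin> C"
    and D_nonempty: "\<And>B C. B \<in> maximal_boxes \<Longrightarrow> C \<in> maximal_boxes \<Longrightarrow> C \<noteq> B \<Longrightarrow> \<sigma> C \<le> \<sigma> B \<Longrightarrow>
      D B \<noteq> {}"
  shows "shellable (cell ` \<B>)"
proof -
  let ?M = "maximal_boxes"
  have M: "B \<in> \<B>" "row ` B = R" "card B = card R + d" "B \<subseteq> V" "finite B" if "B \<in> ?M" for B
    using that subset_V finite_V finite_subset[of B V] by (auto simp: maximal_boxes_def)
  have finM: "finite ?M"
    using finite_V M(4) by (intro finite_subset[of ?M "Pow V"]) auto
  then obtain ys where ys: "set ys = ?M" "distinct ys" using finite_distinct_list by blast
  define xs where "xs = sort_key \<sigma> ys"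
  have xs: "set xs = ?M" "distinct xs" "sorted (map \<sigma> xs)" using ys by (auto simp: xs_def)
  have inj: "inj_on cell ?M"
  proof (rule inj_onI)
    fix B C assume "B \<in> ?M" "C \<in> ?M" "cell B = cell C"
    then show "B = C" using cell_subset_iff M by (metis antisym order.refl)
  qed
  have facets: "set (map cell xs) = facets (cell ` \<B>)" using facets_cells[OF ne] xs by simp
  have dist: "distinct (map cell xs)" using xs inj by (simp add: distinct_map)
  have pure: "pure_complex d (cell ` \<B>)"
    unfolding pure_complex_def facets_cells[OF ne] using aff_dim_cell M by auto
  have "shelling d (cell ` \<B>) (map cell xs)"
  proof (cases d)
    case 0
    then show ?thesis using facets dist pure by simp
  next
    case (Suc k)
    have first: "\<exists>Gs. shelling k (boundary_complex (hd (map cell xs))) Gs"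
    proof -
      have "xs \<noteq> []" using ne xs by auto
      then have "hd xs \<in> ?M" using xs hd_in_set by metis
      then show ?thesis
        using boundary_shelling[of "hd xs" k "removable (hd xs)"] M Suc \<open>xs \<noteq> []\<close>
        by (auto simp: hd_map)
    qed
    have later: "\<exists>Gs r. shelling k (boundary_complex (map cell xs ! j)) Gs \<and> 1 \<le> r \<and> r \<le> length Gs \<and>
        map cell xs ! j \<inter> \<Union>(set (take j (map cell xs))) = \<Union>(set (take r Gs))"
      if j: "0 < j" "j < length (map cell xs)" for j
    proof -
      define B Q where "B = xs ! j" and "Q = set (take j xs)"
      have jl: "j < length xs" using j by simp
      have B: "B \<in> ?M" using jl xs(1) B_def nth_mem by blast
      have Q: "C \<in> ?M" "C \<noteq> B" "\<sigma> C \<le> \<sigma> B" if "C \<in> Q" for C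
      proof -
        obtain i where i: "i < j" "C = xs ! i" using \<open>C \<in> Q\<close> jl by (auto simp: Q_def in_set_conv_nth)
        then show "C \<in> ?M" "C \<noteq> B" using xs jl B_def nth_mem[of i xs] by (auto simp: nth_eq_iff_index_eq)
        show "\<sigma> C \<le> \<sigma> B" using sorted_nth_mono[OF xs(3), of i j] i jl B_def by simp
      qed
      have Q_lower: "C \<in> Q" if C: "C \<in> ?M" "\<sigma> C < \<sigma> B" for C
      proof -
        obtain i where i: "i < length xs" "C = xs ! i" using C xs(1) by (metis in_set_conv_nth)
        then have "i < j" using sorted_nth_mono[OF xs(3), of j i] C jl B_def
          by (force simp: not_less[symmetric])
        then show ?thesis using i jl by (auto simp: Q_def in_set_conv_nth)
      qed
      let ?T = "D B"
      have "xs ! 0 \<in> Q" using j jl by (auto simp: Q_def in_set_conv_nth)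
      then have T_ne: "?T \<noteq> {}" using D_nonempty[OF B] Q by blast
      have finT: "finite ?T" 
        by (rule finite_subset[OF _ M(5)[OF B]]) (use D_removable[OF B] in \<open>auto simp: removable_def\<close>)
      obtain qs where qs: "distinct qs" "set qs = removable B" "set (take (card ?T) qs) = ?T"
        "shelling k (boundary_complex (cell B)) (map (\<lambda>p. cell (B - {p})) qs)"
        using boundary_shelling[OF M(1,2)[OF B], of k ?T] M(3)[OF B] Suc D_removable[OF B] D_good[OF B] T_ne
        by fastforce
      have "card ?T \<le> card (set qs)" using qs(2) D_removable[OF B] by (intro card_mono[OF finite_set]) auto
      then have "card ?T \<le> length qs" using qs(1) by (simp add: distinct_card)
      moreover have "1 \<le> card ?T" using T_ne finT by (simp add: Suc_le_eq card_gt_0_iff)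
      moreover have "cell B \<inter> \<Union>(set (take j (map cell xs))) = (\<Union>p\<in>?T. cell (B - {p}))"
      proof -
        have "cell B \<inter> (\<Union>C\<in>Q. cell C) = (\<Union>C\<in>Q. cell (B \<inter> C))"
          using cell_Int[OF M(1)[OF B] M(1)[OF Q(1)]] by auto
        also have "\<dots> = (\<Union>p\<in>?T. cell (B - {p}))"
        proof (intro equalityI UN_least)
          fix C assume C: "C \<in> Q"
          show "cell (B \<inter> C) \<subseteq> (\<Union>p\<in>?T. cell (B - {p}))"
          proof (cases "row ` (B \<inter> C) = R")
            case True
            then obtain p where p: "p \<in> ?T" "p \<notin> C" using D_separates[OF B] Q[OF C] by blast
            then have "B \<inter> C \<subseteq> B - {p}" by blast
            then have "cell (B \<inter> C) \<subseteq> cell (B - {p})" by (rule cell_mono)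
            then show ?thesis using p by blast
          next
            case False
            moreover have "B \<inter> C \<subseteq> V" using M(4)[OF B] by blast
            ultimately show ?thesis using cell_eq_empty_iff[of "B \<inter> C"] by simp
          qed
        next
          fix p assume "p \<in> ?T"
          then obtain C where C: "C \<in> ?M" "B - {p} \<subseteq> C" "\<sigma> C < \<sigma> B" using D_lower[OF B] by blast
          then have "B - {p} \<subseteq> B \<inter> C" by blast
          then have "cell (B - {p}) \<subseteq> cell (B \<inter> C)" by (rule cell_mono)
          then show "cell (B - {p}) \<subseteq> (\<Union>C\<in>Q. cell (B \<inter> C))" using Q_lower[OF C(1,3)] by blast
        qed
        finally show ?thesis by (simp add: take_map Q_def)
      qed
      moreover have "\<Union>(set (take (card ?T) (map (\<lambda>p. cell (B - {p})) qs))) =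
          (\<Union>p\<in>?T. cell (B - {p}))"
        using qs(3) by (simp add: take_map)
      ultimately show ?thesis
        using qs(4) jl B_def
        by (intro exI[of _ "map (\<lambda>p. cell (B - {p})) qs"] exI[of _ "card ?T"]) simp
    qed
    show ?thesis using pure dist facets first later Suc by simp
  qed
  then show ?thesis using polytopal_complex_cells by (auto simp: shellable_def)
qed

end

section \<open>Staircases\<close>

text \<open>These are the chains of the product order on the grid. Empty rows are allowed, so the
  family is closed under subsets.\<close>

definition staircases :: "nat \<Rightarrow> nat \<Rightarrow> (nat \<times> nat) set set" where
  "staircases t d = {B. B \<subseteq> {..<t} \<times> {..d} \<and>
     (\<forall>k c k' c'. (k, c) \<in> B \<longrightarrow> (k', c') \<in> B \<longrightarrow> k < k' \<longrightarrow> c \<le> c')}"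

lemma staircases_subset: "B \<in> staircases t d \<Longrightarrow> B \<subseteq> {..<t} \<times> {..d}"
  by (simp add: staircases_def)

lemma staircasesD:
  "B \<in> staircases t d \<Longrightarrow> (k, c) \<in> B \<Longrightarrow> (k', c') \<in> B \<Longrightarrow> k < k' \<Longrightarrow> c \<le> c'"
  by (auto simp: staircases_def)

lemma staircases_down: "B \<in> staircases t d \<Longrightarrow> C \<subseteq> B \<Longrightarrow> C \<in> staircases t d"
  unfolding staircases_def by blast

lemma finite_staircase: "B \<in> staircases t d \<Longrightarrow> finite B"
  by (rule finite_subset[OF staircases_subset]) auto

text \<open>\<open>k + c\<close> is the rank in the product order and increases strictly along a
  chain. A staircase thus has at most \<open>t + d\<close> points, and one of that size meets every
  antidiagonal exactly once.\<close>

lemma inj_on_staircase: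
  assumes "B \<in> staircases t d"
  shows "inj_on (\<lambda>(k, c). k + c) B"
proof (rule inj_onI, clarify)
  fix k c k' c' assume *: "(k, c) \<in> B" "(k', c') \<in> B" "k + c = k' + c'"
  then show "k = k' \<and> c = c'"
    using staircasesD[OF assms, of k c k' c'] staircasesD[OF assms, of k' c' k c]
    by (cases k k' rule: linorder_cases) auto
qed

lemma staircase_image_subset:
  assumes "B \<in> staircases t d"
  shows "(\<lambda>(k, c). k + c) ` B \<subseteq> {..<t + d}"
  using staircases_subset[OF assms] by fastforce

lemma maximal_staircase_image:
  assumes "B \<in> staircases t d" "card B = t + d"
  shows "(\<lambda>(k, c). k + c) ` B = {..<t + d}"
  using staircase_image_subset[OF assms(1)] card_image[OF inj_on_staircase[OF assms(1)]] assms(2)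
  by (intro card_subset_eq) auto

text \<open>Some antidiagonal \<open>s\<close> is missed. The new point lies on it, in the last row
  \<open>k\<close> that has a point below it; since the next row is nonempty and lies entirely above
  it, monotonicity survives and the column stays within \<open>d\<close>.\<close>

lemma staircase_insert:
  assumes B: "B \<in> staircases t d" and full: "fst ` B = {..<t}" and "0 < t" and "card B < t + d"
  obtains p where "p \<notin> B" "insert p B \<in> staircases t d"
proof -
  have "card ((\<lambda>(k, c). k + c) ` B) < card {..<t + d}"
    using card_image[OF inj_on_staircase[OF B]] assms by simp
  then obtain s where s: "s < t + d" "s \<notin> (\<lambda>(k, c). k + c) ` B"
    using staircase_image_subset[OF B] by (metis lessThan_iff less_irrefl subset_antisym subsetI)
  have B_ne: "k + c \<noteq> s" if "(k, c) \<in> B" for k c using s(2) that by force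
  have row: "\<exists>c. (k, c) \<in> B" if "k < t" for k
  proof -
    have "k \<in> fst ` B" using full that by simp
    then show ?thesis by force
  qed
  \<comment> \<open>Row 0 always qualifies, which covers the case that no row has a point below the
    antidiagonal.\<close>
  define P where "P = (\<lambda>k. k < t \<and> (k = 0 \<or> (\<exists>c. (k, c) \<in> B \<and> k + c < s)))"
  define k where "k = (GREATEST k. P k)"
  have bound: "\<forall>k. P k \<longrightarrow> k \<le> t" by (auto simp: P_def)
  have "P 0" using \<open>0 < t\<close> by (simp add: P_def)
  then have Pk: "P k" and k_max: "\<And>k'. P k' \<Longrightarrow> k' \<le> k"
    unfolding k_def using GreatestI_nat[of P 0 t] Greatest_le_nat[of P _ t] bound by auto
  have above: "s < k' + c'" if "(k', c') \<in> B" "k < k'" for k' c'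
  proof (rule ccontr)
    assume "\<not> s < k' + c'"
    then have "P k'" using that B_ne[OF that(1)] staircases_subset[OF B] by (auto simp: P_def)
    then show False using k_max that by force
  qed
  have ks: "k \<le> s" using Pk by (auto simp: P_def)
  have kt: "k < t" using Pk by (auto simp: P_def)
  have below: "c' \<le> s - k" if c': "(k', c') \<in> B" "k' < k" for k' c'
  proof -
    obtain c where c: "(k, c) \<in> B" "k + c < s" using Pk c' by (auto simp: P_def)
    then show ?thesis using staircasesD[OF B c'(1) c(1) c'(2)] by simp
  qed
  have right: "s - k \<le> c'" if c': "(k', c') \<in> B" "k < k'" for k' c'
  proof -
    show ?thesis
    proof (cases "Suc k = k'")
      case True
      then show ?thesis using above[OF c'] by simp
    next
      case False
      then have k': "Suc k < k'" using c'(2) by simp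
      then have "Suc k < t" using c'(1) staircases_subset[OF B] by auto
      then obtain c1 where c1: "(Suc k, c1) \<in> B" using row by blast
      then have "s - k \<le> c1" using above by force
      also have "c1 \<le> c'" using staircasesD[OF B c1 c'(1) k'] .
      finally show ?thesis .
    qed
  qed
  have "s - k \<le> d"
  proof (cases "Suc k = t")
    case True
    then show ?thesis using s by simp
  next
    case False
    then have "Suc k < t" using kt by simp
    then obtain c1 where "(Suc k, c1) \<in> B" using row by blast
    then show ?thesis using right[of "Suc k" c1] staircases_subset[OF B] by force
  qed
  then have "insert (k, s - k) B \<in> staircases t d"
    using B kt below right unfolding staircases_def by auto
  moreover have "(k, s - k) \<notin> B" using B_ne ks by force
  ultimately show ?thesis using that by blast
qed

lemma staircase_extend:
  assumes "B \<in> staircases t d" "fst ` B = {..<t}" "0 < t"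
  shows "\<exists>C\<in>staircases t d. B \<subseteq> C \<and> card C = t + d"
  using assms
proof (induction "t + d - card B" arbitrary: B)
  case 0
  have "card B \<le> t + d"
    using card_mono[OF _ staircase_image_subset[OF 0(2)]] card_image[OF inj_on_staircase[OF 0(2)]] by simp
  then show ?case using 0 by auto
next
  case (Suc n)
  then have "card B < t + d" by simp
  then obtain p where p: "p \<notin> B" "insert p B \<in> staircases t d"
    using staircase_insert Suc.prems by metis
  have "fst ` insert p B = {..<t}"
    using Suc.prems(2) staircases_subset[OF p(2)] by auto
  moreover have "n = t + d - card (insert p B)"
    using Suc(2) p finite_staircase[OF Suc.prems(1)] by simp
  ultimately obtain C where "C \<in> staircases t d" "insert p B \<subseteq> C" "card C = t + d"
    using Suc(1) p(2) Suc.prems(3) by blast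
  then show ?case by blast
qed

lemma ex_maximal_staircase:
  assumes "0 < t"
  shows "\<exists>B\<in>staircases t d. fst ` B = {..<t} \<and> card B = t + d"
proof -
  let ?B = "{..<t} \<times> {0::nat}"
  have "?B \<in> staircases t d" "fst ` ?B = {..<t}" by (auto simp: staircases_def)
  then obtain C where C: "C \<in> staircases t d" "?B \<subseteq> C" "card C = t + d"
    using staircase_extend assms by metis
  then have "fst ` C = {..<t}" using staircases_subset[OF C(1)] by force
  then show ?thesis using C by blast
qed

text \<open>A maximal staircase is a lattice path. Flipping a corner so that one step moves to the
  previous row lowers \<open>height\<close> by one; \<open>corners\<close> are the points at which this is possible.\<close>

definition height :: "(nat \<times> nat) set \<Rightarrow> nat" where
  "height B = (\<Sum>p\<in>B. fst p)"

definition corners :: "(nat \<times> nat) set \<Rightarrow> (nat \<times> nat) set" where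
  "corners B = {(k, c) \<in> B. 0 < k \<and> (\<exists>c'. (k, c') \<in> B \<and> c < c') \<and> (\<forall>c'. (k, c') \<in> B \<longrightarrow> c \<le> c')}"

text \<open>The corner \<open>(k, c)\<close> moves along its antidiagonal to
  \<open>(k - 1, Suc c)\<close>. This respects the order because \<open>c\<close> is leftmost in its
  row and all remaining points from row \<open>k\<close> on have columns beyond
  \<open>c\<close>.\<close>

lemma flip_corner:
  assumes B: "B \<in> staircases t d" and p: "p \<in> corners B"
  obtains C where "C \<in> staircases t d" "B - {p} \<subseteq> C" "card C = card B" "height C < height B"
proof -
  obtain k c c' where kc: "p = (k, c)" "(k, c) \<in> B" "0 < k" "(k, c') \<in> B" "c < c'"
    and min: "\<And>c''. (k, c'') \<in> B \<Longrightarrow> c \<le> c''"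
    using p by (auto simp: corners_def)
  let ?q = "(k - 1, Suc c)"
  let ?C = "insert ?q (B - {p})"
  have q: "?q \<notin> B" using staircasesD[OF B _ kc(2), of "k - 1" "Suc c"] kc(3) by auto
  have fin: "finite B" using B by (rule finite_staircase)
  have "k < t" "Suc c \<le> d" using kc staircases_subset[OF B] by auto
  moreover have "c1 \<le> Suc c" if "(k1, c1) \<in> B" "k1 < k - 1" for k1 c1
  proof -
    have "k1 < k" using that(2) by simp
    then show ?thesis using staircasesD[OF B that(1) kc(2)] by simp
  qed
  moreover have "Suc c \<le> c1" if "(k1, c1) \<in> B - {p}" "k - 1 < k1" for k1 c1
  proof (cases "k1 = k")
    case True
    then show ?thesis using that min[of c1] kc(1) by (auto simp: le_less Suc_le_eq)
  next
    case False
    then have "c' \<le> c1" using that by (intro staircasesD[OF B kc(4)]) auto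
    then show ?thesis using kc(5) by simp
  qed
  ultimately have "?C \<in> staircases t d"
    using B unfolding staircases_def by auto
  moreover have "card ?C = card B"
    using q kc(1,2) fin card_Suc_Diff1[of B p] by simp
  moreover have "height ?C < height B"
    using q kc fin by (simp add: height_def sum.remove[of B p fst])
  ultimately show ?thesis using that by blast
qed

text \<open>Index both paths by antidiagonals. If \<open>C\<close> were nowhere in a smaller row
  than \<open>B\<close>, comparing the sums of rows would force equality on every
  antidiagonal.\<close>

lemma lower_entry:
  assumes B: "B \<in> staircases t d" "card B = t + d" and C: "C \<in> staircases t d" "card C = t + d"
    and "C \<noteq> B" "height C \<le> height B"
  obtains k c k' c' where "(k, c) \<in> B" "(k', c') \<in> C" "k + c = k' + c'" "k' < k"
proof (rule ccontr)
  assume not_thesis: "\<not> thesis"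
  note witness = that
  have no: "k \<le> k'" if "(k, c) \<in> B" "(k', c') \<in> C" "k + c = k' + c'" for k c k' c'
    using witness[OF that] not_thesis by (rule_tac ccontr) simp
  let ?s = "\<lambda>(k, c). k + c :: nat"
  let ?N = "{..<t + d}"
  let ?f = "\<lambda>n. fst (inv_into B ?s n)" and ?g = "\<lambda>n. fst (inv_into C ?s n)"
  have hB: "height B = (\<Sum>n\<in>?N. ?f n)"
    unfolding height_def maximal_staircase_image[OF B, symmetric]
    using inj_on_staircase[OF B(1)] by (simp add: sum.reindex)
  have hC: "height C = (\<Sum>n\<in>?N. ?g n)"
    unfolding height_def maximal_staircase_image[OF C, symmetric]
    using inj_on_staircase[OF C(1)] by (simp add: sum.reindex)
  have mem: "inv_into B ?s n \<in> B" "inv_into C ?s n \<in> C" "?s (inv_into B ?s n) = n"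
    "?s (inv_into C ?s n) = n" if "n \<in> ?N" for n
    using that maximal_staircase_image[OF B] maximal_staircase_image[OF C]
    by (metis inv_into_into, metis inv_into_into, metis f_inv_into_f, metis f_inv_into_f)
  have le: "?f n \<le> ?g n" if "n \<in> ?N" for n
    using mem[OF that] no[of "?f n" "snd (inv_into B ?s n)" "?g n" "snd (inv_into C ?s n)"]
    by (simp add: case_prod_unfold)
  have eq: "?f n = ?g n" if "n \<in> ?N" for n
  proof (rule ccontr)
    assume "?f n \<noteq> ?g n"
    then have "(\<Sum>n\<in>?N. ?f n) < (\<Sum>n\<in>?N. ?g n)"
      using le that by (intro sum_strict_mono_ex1) (auto simp: le_less)
    then show False using hB hC \<open>height C \<le> height B\<close> by simp
  qed
  have inv_eq: "inv_into B ?s n = inv_into C ?s n" if "n \<in> ?N" for n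
    using eq[OF that] mem(3,4)[OF that] by (simp add: case_prod_unfold prod_eq_iff)
  have sub: "B \<subseteq> C"
  proof
    fix p assume p: "p \<in> B"
    then have "?s p \<in> ?N" using maximal_staircase_image[OF B] by blast
    from inv_eq[OF this] mem(2)[OF this] show "p \<in> C"
      using inv_into_f_f[OF inj_on_staircase[OF B(1)] p] by simp
  qed
  then have "B = C" using card_subset_eq[OF finite_staircase[OF C(1)]] B(2) C(2) by simp
  then show False using \<open>C \<noteq> B\<close> by simp
qed

text \<open>On some antidiagonal \<open>C\<close> lies in an earlier row than \<open>B\<close>,
  hence in a larger column, so in row \<open>k\<close> it stays to the right of that column and
  avoids the leftmost point of \<open>B\<close>. A common point in row \<open>k\<close> then makes
  this leftmost point a corner.\<close>

lemma corner_separates: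
  assumes B: "B \<in> staircases t d" "card B = t + d" and C: "C \<in> staircases t d" "card C = t + d"
    and "C \<noteq> B" "height C \<le> height B" and full: "fst ` (B \<inter> C) = {..<t}"
  shows "\<exists>p\<in>corners B. p \<notin> C"
proof -
  obtain k c k' c' where kc: "(k, c) \<in> B" "(k', c') \<in> C" "k + c = k' + c'" "k' < k"
    by (rule lower_entry[OF assms(1-6)])
  define c0 where "c0 = (LEAST c. (k, c) \<in> B)"
  have c0: "(k, c0) \<in> B" "\<And>c. (k, c) \<in> B \<Longrightarrow> c0 \<le> c"
    unfolding c0_def using kc(1) by (auto intro: LeastI Least_le)
  have nC: "(k, c0) \<notin> C"
    using staircasesD[OF C(1) kc(2) _ kc(4)] c0(2)[OF kc(1)] kc by fastforce
  have "k \<in> fst ` (B \<inter> C)" using full kc(1) staircases_subset[OF B(1)] by auto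
  then obtain c1 where "(k, c1) \<in> B" "(k, c1) \<in> C" by force
  then have "(k, c1) \<in> B" "c0 < c1" using nC c0(2)[of c1] by (auto simp: le_less)
  then have "(k, c0) \<in> corners B" using c0 kc(4) by (auto simp: corners_def)
  then show ?thesis using nC by blast
qed

text \<open>Without corners every row after the first has at most one point, so by counting row 0
  contains all columns and later rows sit in column \<open>d\<close>. This is the path of least
  height, and a different path cannot be lower on any antidiagonal.\<close>

lemma corners_nonempty:
  assumes B: "B \<in> staircases t d" "card B = t + d" and C: "C \<in> staircases t d" "card C = t + d"
    and "C \<noteq> B" "height C \<le> height B" "0 < t" "fst ` B = {..<t}"
  shows "corners B \<noteq> {}"
proof
  assume empty: "corners B = {}"
  obtain k c k' c' where kc: "(k, c) \<in> B" "(k', c') \<in> C" "k + c = k' + c'" "k' < k"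
    by (rule lower_entry[OF assms(1-6)])
  have single: "c1 = c2" if "0 < k" "(k, c1) \<in> B" "(k, c2) \<in> B" for k c1 c2
  proof -
    define c0 where "c0 = (LEAST c. (k, c) \<in> B)"
    have c0: "(k, c0) \<in> B" "\<And>c. (k, c) \<in> B \<Longrightarrow> c0 \<le> c"
      unfolding c0_def using that by (auto intro: LeastI Least_le)
    have "c3 = c0" if "(k, c3) \<in> B" for c3
    proof (rule ccontr)
      assume "c3 \<noteq> c0"
      then have "(k, c0) \<in> corners B"
        using that c0 \<open>0 < k\<close> c0(2)[OF that] by (auto simp: corners_def le_less)
      then show False using empty by simp
    qed
    then show ?thesis using that by metis
  qed
  let ?B0 = "{c. (0, c) \<in> B}"
  have B0: "?B0 \<subseteq> {..d}" using staircases_subset[OF B(1)] by auto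
  have "B \<subseteq> Pair 0 ` ?B0 \<union> {p \<in> B. 0 < fst p}" by (auto simp: image_iff)
  then have "card B \<le> card (Pair (0::nat) ` ?B0 \<union> {p \<in> B. 0 < fst p})"
    using finite_staircase[OF B(1)] B0 by (intro card_mono) (auto intro: finite_subset)
  also have "\<dots> \<le> card (Pair (0::nat) ` ?B0) + card {p \<in> B. 0 < fst p}" by (rule card_Un_le)
  also have "card (Pair (0::nat) ` ?B0) = card ?B0" by (intro card_image inj_onI) simp
  also have "card {p \<in> B. 0 < fst p} \<le> card {1..<t}"
  proof (rule card_inj_on_le)
    show "inj_on fst {p \<in> B. 0 < fst p}" using single by (auto intro!: inj_onI)
    show "fst ` {p \<in> B. 0 < fst p} \<subseteq> {1..<t}" using staircases_subset[OF B(1)] by auto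
  qed simp
  finally have "card {..d} \<le> card ?B0" using B(2) \<open>0 < t\<close> by simp
  then have "?B0 = {..d}" using B0 by (intro card_seteq) auto
  then have "(0, d) \<in> B" by auto
  then have "d \<le> c" using staircasesD[OF B(1) _ kc(1)] kc(4) by auto
  moreover have "c' \<le> d" using kc(2) staircases_subset[OF C(1)] by auto
  ultimately show False using kc(3,4) by simp
qed

section \<open>The staircase subdivision of a dilated simplex\<close>

text \<open>\<open>clamp (x - k)\<close> is the length of the part of the interval from
  \<open>k\<close> to \<open>k + 1\<close> left of \<open>x\<close>: the content of bin
  \<open>k\<close> when an amount \<open>x\<close> is poured into unit bins in order.\<close>

definition clamp :: "real \<Rightarrow> real" where
  "clamp x = max 0 (min 1 x)"

lemma clamp_mono: "x \<le> y \<Longrightarrow> clamp x \<le> clamp y"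
  by (auto simp: clamp_def)

lemma sum_clamp:
  assumes "0 \<le> x" "x \<le> real t"
  shows "(\<Sum>k<t. clamp (x - real k)) = x"
proof -
  have "(\<Sum>k<t. clamp (x - real k)) = min x (real t)" if "0 \<le> x" for x t
    using that by (induction t) (auto simp: clamp_def)
  then show ?thesis using assms by simp
qed

text \<open>Contents of unit bins in which a bin is used only when all earlier ones are full can
  only come from filling greedily, so the total determines them.\<close>

lemma eq_clamp:
  fixes g :: "nat \<Rightarrow> real"
  assumes bounds: "\<And>i. i < t \<Longrightarrow> 0 \<le> g i \<and> g i \<le> 1"
    and step: "\<And>i j. i < j \<Longrightarrow> j < t \<Longrightarrow> 0 < g j \<Longrightarrow> g i = 1"
    and k: "k < t"
  shows "g k = clamp ((\<Sum>i<t. g i) - real k)"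
proof -
  let ?A = "\<Sum>i<k. g i" and ?L = "\<Sum>i\<in>{k<..<t}. g i"
  have "{..<t} = {..<k} \<union> insert k {k<..<t}" using k by auto
  then have "(\<Sum>i<t. g i) = (\<Sum>i\<in>{..<k} \<union> insert k {k<..<t}. g i)" by simp
  also have "\<dots> = ?A + (\<Sum>i\<in>insert k {k<..<t}. g i)" by (intro sum.union_disjoint) auto
  also have "(\<Sum>i\<in>insert k {k<..<t}. g i) = g k + ?L" by simp
  finally have S: "(\<Sum>i<t. g i) = ?A + (g k + ?L)" .
  have A_le: "?A \<le> real k"
    using sum_bounded_above[of "{..<k}" g 1] bounds k by simp
  have L_ge: "0 \<le> ?L" using bounds by (intro sum_nonneg) auto
  have A: "?A = real k" if "0 < g k"
  proof -
    have "?A = (\<Sum>i<k. 1)" using step[OF _ k that] by (intro sum.cong) auto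
    then show ?thesis by simp
  qed
  have L: "?L = 0" if "g k \<noteq> 1"
  proof -
    have "g i = 0" if "i \<in> {k<..<t}" for i
      using step[of k i] that \<open>g k \<noteq> 1\<close> bounds[of i] by force
    then show ?thesis by simp
  qed
  consider "g k = 0" | "0 < g k" "g k < 1" | "g k = 1" using bounds[OF k] by fastforce
  then show ?thesis
  proof cases
    case 1
    then show ?thesis using S A_le L by (simp add: clamp_def)
  next
    case 2
    then show ?thesis using S A L by (simp add: clamp_def)
  next
    case 3
    then show ?thesis using S A L_ge by (simp add: clamp_def)
  qed
qed

locale staircase_realization =
  fixes t d :: nat and v :: "nat \<Rightarrow> 'a::euclidean_space"
  assumes t_pos: "0 < t" and inj_v: "inj_on v {..d}"
    and independent_v: "\<not> affine_dependent (v ` {..d})"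
begin

text \<open>A point of the grid is placed according to its column alone, so every factor is a face
  of the same simplex and only column sums affect \<open>combo\<close>.\<close>

sublocale box_frame "{..<t} \<times> {..d}" fst "{..<t}" "\<lambda>p. v (snd p)"
  using t_pos by unfold_locales auto

lemma row_sum:
  assumes "\<mu> \<in> weights B" "k < t"
  shows "(\<Sum>c\<le>d. \<mu> (k, c)) = 1"
proof -
  have "{p \<in> {..<t} \<times> {..d}. fst p = k} = Pair k ` {..d}" using assms(2) by auto
  then have "(\<Sum>p | p \<in> {..<t} \<times> {..d} \<and> fst p = k. \<mu> p) = (\<Sum>p\<in>Pair k ` {..d}. \<mu> p)" by simp
  also have "\<dots> = (\<Sum>c\<le>d. \<mu> (k, c))" by (subst sum.reindex) (auto intro: inj_onI)
  finally show ?thesis using weights_row[OF assms(1), of k] assms(2) by simp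
qed

lemma combo_columns: "combo \<mu> = (\<Sum>c\<le>d. (\<Sum>k<t. \<mu> (k, c)) *\<^sub>R v c)"
proof -
  have "combo \<mu> = (\<Sum>k<t. \<Sum>c\<le>d. \<mu> (k, c) *\<^sub>R v c)"
    by (simp add: combo_def sum.cartesian_product case_prod_unfold)
  also have "\<dots> = (\<Sum>c\<le>d. \<Sum>k<t. \<mu> (k, c) *\<^sub>R v c)" by (rule sum.swap)
  finally show ?thesis by (simp add: scaleR_sum_left)
qed

text \<open>The coefficient sums need only agree, not be 1: column sums add up to \<open>t\<close>,
  and dilated points are compared with zero coefficients.\<close>

lemma affine_coordinates_unique:
  assumes "(\<Sum>c\<le>d. a c *\<^sub>R v c) = (\<Sum>c\<le>d. b c *\<^sub>R v c)" "(\<Sum>c\<le>d. a c) = (\<Sum>c\<le>d. b c)" "c \<le> d"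
  shows "a c = b c"
proof (rule ccontr)
  assume "a c \<noteq> b c"
  let ?u = "\<lambda>x. a (inv_into {..d} v x) - b (inv_into {..d} v x)"
  have u: "?u (v i) = a i - b i" if "i \<le> d" for i using inv_into_f_f[OF inj_v] that by simp
  have "sum ?u (v ` {..d}) = (\<Sum>i\<le>d. a i - b i)"
    using u by (simp add: sum.reindex[OF inj_v])
  moreover have "(\<Sum>x\<in>v ` {..d}. ?u x *\<^sub>R x) = (\<Sum>i\<le>d. (a i - b i) *\<^sub>R v i)"
    using u by (simp add: sum.reindex[OF inj_v])
  ultimately have "sum ?u (v ` {..d}) = 0" "(\<Sum>x\<in>v ` {..d}. ?u x *\<^sub>R x) = 0"
    using assms by (simp_all add: sum_subtractf scaleR_diff_left)
  moreover have "?u (v c) \<noteq> 0" using u[OF assms(3)] \<open>a c \<noteq> b c\<close> by simp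
  ultimately have "affine_dependent (v ` {..d})"
    unfolding affine_dependent_explicit_finite[OF finite_imageI[OF finite_atMost]]
    using assms(3) by (intro exI[of _ ?u] conjI bexI[of _ "v c"]) auto
  then show False using independent_v by simp
qed

text \<open>Northwest corner rule: weights supported on a staircase are determined by their column sums.\<close>

lemma partial_row_sum:
  assumes B: "B \<in> staircases t d" and \<mu>: "\<mu> \<in> weights B" and k: "k < t" and n: "n \<le> Suc d"
  shows "(\<Sum>c<n. \<mu> (k, c)) = clamp ((\<Sum>c<n. \<Sum>i<t. \<mu> (i, c)) - real k)"
proof -
  let ?g = "\<lambda>i. \<Sum>c<n. \<mu> (i, c)"
  have sub: "{..<n} \<subseteq> {..d}" using n by auto
  have "?g k = clamp ((\<Sum>i<t. ?g i) - real k)"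
  proof (rule eq_clamp)
    fix i assume i: "i < t"
    have "?g i \<le> (\<Sum>c\<le>d. \<mu> (i, c))"
      using sub weights_nonneg[OF \<mu>] by (intro sum_mono2) auto
    then show "0 \<le> ?g i \<and> ?g i \<le> 1"
      using row_sum[OF \<mu> i] weights_nonneg[OF \<mu>] by (simp add: sum_nonneg)
  next
    \<comment> \<open>The bins are the rows. Weight of row \<open>j\<close> left of column
      \<open>n\<close> forces the earlier row \<open>i\<close> to lie left of \<open>n\<close>
      entirely, so bin \<open>i\<close> is full.\<close>
    fix i j assume ij: "i < j" "j < t" "0 < ?g j"
    then obtain c where c: "c < n" "\<mu> (j, c) \<noteq> 0"
      by (metis (mono_tags, lifting) lessThan_iff less_irrefl sum.neutral)
    then have jc: "(j, c) \<in> B" using weights_zero[OF \<mu>] by blast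
    have "?g i = (\<Sum>c\<le>d. \<mu> (i, c))"
    proof (rule sum.mono_neutral_left[OF _ sub])
      show "\<forall>c'\<in>{..d} - {..<n}. \<mu> (i, c') = 0"
      proof
        fix c' assume "c' \<in> {..d} - {..<n}"
        then have "(i, c') \<notin> B" using staircasesD[OF B _ jc ij(1), of c'] c(1) by auto
        then show "\<mu> (i, c') = 0" using weights_zero[OF \<mu>] by blast
      qed
    qed simp
    then show "?g i = 1" using row_sum[OF \<mu>, of i] ij by simp
  qed (rule k)
  also have "(\<Sum>i<t. ?g i) = (\<Sum>c<n. \<Sum>i<t. \<mu> (i, c))" by (rule sum.swap)
  finally show ?thesis .
qed

lemma total_weight:
  assumes "\<mu> \<in> weights B"
  shows "(\<Sum>c\<le>d. \<Sum>k<t. \<mu> (k, c)) = real t"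
proof -
  have "(\<Sum>c\<le>d. \<Sum>k<t. \<mu> (k, c)) = (\<Sum>k<t. \<Sum>c\<le>d. \<mu> (k, c))" by (rule sum.swap)
  also have "\<dots> = (\<Sum>k<t. 1)" using row_sum[OF assms] by (intro sum.cong) auto
  finally show ?thesis by simp
qed

text \<open>The formula in \<open>partial_row_sum\<close> involves the column sums but not the
  staircase, so it applies to both sides; an entry is the difference of two consecutive partial
  sums.\<close>

lemma staircase_weights_unique:
  assumes B: "B \<in> staircases t d" "\<mu> \<in> weights B" and C: "C \<in> staircases t d" "\<nu> \<in> weights C"
    and eq: "combo \<mu> = combo \<nu>"
  shows "\<mu> = \<nu>"
proof
  fix p
  have columns: "(\<Sum>k<t. \<mu> (k, c)) = (\<Sum>k<t. \<nu> (k, c))" if "c \<le> d" for c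
    using eq total_weight[OF B(2)] total_weight[OF C(2)] that
    by (intro affine_coordinates_unique[where a = "\<lambda>c. \<Sum>k<t. \<mu> (k, c)"]) (auto simp: combo_columns)
  have partial: "(\<Sum>c<n. \<mu> (k, c)) = (\<Sum>c<n. \<nu> (k, c))" if "k < t" "n \<le> Suc d" for k n
  proof -
    have "(\<Sum>c<n. \<Sum>i<t. \<mu> (i, c)) = (\<Sum>c<n. \<Sum>i<t. \<nu> (i, c))"
      using columns that(2) by (rule_tac sum.cong[OF refl]) simp
    then show ?thesis using partial_row_sum[OF B that] partial_row_sum[OF C that] by simp
  qed
  show "\<mu> p = \<nu> p"
  proof (cases "p \<in> {..<t} \<times> {..d}")
    case True
    then obtain k c where p: "p = (k, c)" "k < t" "c \<le> d" by auto
    then show ?thesis using partial[of k c] partial[of k "Suc c"] by simp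
  next
    case False
    then have "p \<notin> B" "p \<notin> C"
      using staircases_subset[OF B(1)] staircases_subset[OF C(1)] by blast+
    then show ?thesis using weights_zero[OF B(2)] weights_zero[OF C(2)] by simp
  qed
qed

sublocale box_complex "{..<t} \<times> {..d}" fst "{..<t}" "\<lambda>p. v (snd p)" "staircases t d"
proof
  show "inj_on combo (\<Union>(weights ` staircases t d))"
    by (rule inj_onI) (use staircase_weights_unique in blast)
qed (use staircases_subset staircases_down in blast)+

section \<open>The cells cover exactly the dilated simplex\<close>

lemma cell_subset_simplex: "cell B \<subseteq> convex hull ((\<lambda>c. real t *\<^sub>R v c) ` {..d})"
proof
  fix x assume "x \<in> cell B"
  then obtain \<mu> where \<mu>: "\<mu> \<in> weights B" "x = combo \<mu>" by (auto simp: cell_def)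
  let ?y = "\<lambda>c. (\<Sum>k<t. \<mu> (k, c)) / real t"
  have "(\<Sum>c\<le>d. ?y c *\<^sub>R (real t *\<^sub>R v c)) \<in> convex hull ((\<lambda>c. real t *\<^sub>R v c) ` {..d})"
  proof (rule convex_sum)
    show "(\<Sum>c\<le>d. ?y c) = 1"
      using total_weight[OF \<mu>(1)] t_pos by (simp add: sum_divide_distrib[symmetric])
    show "0 \<le> ?y c" for c using weights_nonneg[OF \<mu>(1)] by (simp add: sum_nonneg)
  qed (auto intro: hull_inc)
  then show "x \<in> convex hull ((\<lambda>c. real t *\<^sub>R v c) ` {..d})"
    using t_pos by (simp add: \<mu>(2) combo_columns)
qed

text \<open>Existence half of the northwest corner rule. Lay the column sums end to end on the
  interval from 0 to \<open>t\<close> and cut it into unit pieces, one per row; an entry is the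
  length of the overlap of a column piece with a row piece.\<close>

lemma simplex_subset_cells:
  assumes "x \<in> convex hull ((\<lambda>c. real t *\<^sub>R v c) ` {..d})"
  shows "\<exists>B\<in>staircases t d. x \<in> cell B"
proof -
  let ?P = "(\<lambda>c. real t *\<^sub>R v c) ` {..d}"
  have inj: "inj_on (\<lambda>c. real t *\<^sub>R v c) {..d}"
    using inj_v t_pos by (auto simp: inj_on_def)
  obtain u where u: "\<forall>y\<in>?P. 0 \<le> u y" "sum u ?P = 1" "(\<Sum>y\<in>?P. u y *\<^sub>R y) = x"
    using assms by (auto simp: convex_hull_finite)
  define z where "z c = real t * u (real t *\<^sub>R v c)" for c
  have z_nonneg: "0 \<le> z c" if "c \<le> d" for c using u(1) that by (simp add: z_def)
  have z_sum: "(\<Sum>c\<le>d. z c) = real t"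
    using u(2) by (simp add: z_def sum.reindex[OF inj] sum_distrib_left[symmetric])
  have x: "x = (\<Sum>c\<le>d. z c *\<^sub>R v c)"
    using u(3) by (simp add: z_def sum.reindex[OF inj] mult.commute)
  define W where "W n = (\<Sum>c<n. z c)" for n
  have W_mono: "W i \<le> W j" if "i \<le> j" "j \<le> Suc d" for i j
    unfolding W_def using that z_nonneg by (intro sum_mono2) auto
  have W_top: "W (Suc d) = real t" unfolding W_def using z_sum by (simp add: lessThan_Suc_atMost)
  define \<mu> where "\<mu> = (\<lambda>(k, c). if k < t \<and> c \<le> d
    then clamp (W (Suc c) - real k) - clamp (W c - real k) else 0)"
  have W_step: "clamp (W c - real k) \<le> clamp (W (Suc c) - real k)" if "c \<le> d" for k c
    using W_mono[of c "Suc c"] that by (intro clamp_mono) auto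
  define B where "B = {p. \<mu> p \<noteq> 0}"
  have "B \<in> staircases t d"
    unfolding staircases_def
  proof (intro CollectI conjI allI impI)
    show "B \<subseteq> {..<t} \<times> {..d}" by (auto simp: B_def \<mu>_def split: if_splits)
    fix k c k' c' assume *: "(k, c) \<in> B" "(k', c') \<in> B" "k < k'"
    then have cd: "c \<le> d" "c' \<le> d" by (auto simp: B_def \<mu>_def split: if_splits)
    have "clamp (W (Suc c) - real k) \<noteq> clamp (W c - real k)"
      using *(1) by (auto simp: B_def \<mu>_def split: if_splits)
    \<comment> \<open>A nonzero overlap puts the left end of column piece \<open>c\<close> before
      the end of row piece \<open>k\<close>, hence before the right end of column piece
      \<open>c'\<close>.\<close>
    then have "W c < real k + 1"
      using W_mono[of c "Suc c"] cd by (auto simp: clamp_def split: if_splits)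
    moreover have "clamp (W (Suc c') - real k') \<noteq> clamp (W c' - real k')"
      using *(2) by (auto simp: B_def \<mu>_def split: if_splits)
    then have "real k' < W (Suc c')"
      using W_mono[of c' "Suc c'"] cd by (auto simp: clamp_def split: if_splits)
    ultimately have "W c < W (Suc c')" using *(3) by simp
    then show "c \<le> c'" using W_mono[of "Suc c'" c] cd by (auto simp: not_less_eq_eq[symmetric])
  qed
  moreover have "\<mu> \<in> weights B"
  proof -
    have "(\<Sum>p | p \<in> {..<t} \<times> {..d} \<and> fst p = k. \<mu> p) = 1" if k: "k < t" for k
    proof -
      have "{p \<in> {..<t} \<times> {..d}. fst p = k} = Pair k ` {..d}" using k by auto
      then have "(\<Sum>p | p \<in> {..<t} \<times> {..d} \<and> fst p = k. \<mu> p) = (\<Sum>c\<le>d. \<mu> (k, c))"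
        by (simp add: sum.reindex inj_on_def)
      also have "\<dots> = (\<Sum>c\<le>d. clamp (W (Suc c) - real k) - clamp (W c - real k))"
        using k by (intro sum.cong) (auto simp: \<mu>_def)
      also have "\<dots> = clamp (W (Suc d) - real k) - clamp (W 0 - real k)"
        unfolding lessThan_Suc_atMost[symmetric] by (rule sum_lessThan_telescope)
      also have "\<dots> = 1" using k by (simp add: W_top W_def[of 0] clamp_def)
      finally show ?thesis .
    qed
    moreover have "0 \<le> \<mu> p" for p
      using W_step by (cases p) (auto simp: \<mu>_def)
    ultimately show ?thesis by (auto simp: weights_def B_def)
  qed
  moreover have "combo \<mu> = x"
  proof -
    have "(\<Sum>k<t. \<mu> (k, c)) = z c" if c: "c \<le> d" for c
    proof -
      have "(\<Sum>k<t. \<mu> (k, c)) = (\<Sum>k<t. clamp (W (Suc c) - real k)) - (\<Sum>k<t. clamp (W c - real k))"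
        using c by (simp add: \<mu>_def sum_subtractf)
      also have "\<dots> = W (Suc c) - W c"
        using W_mono[of 0 "Suc c"] W_mono[of "Suc c" "Suc d"] W_mono[of 0 c] W_mono[of c "Suc d"]
          W_top c
        by (simp add: sum_clamp W_def[of 0])
      finally show ?thesis by (simp add: W_def)
    qed
    then show ?thesis unfolding combo_columns x by (intro sum.cong) auto
  qed
  ultimately show ?thesis unfolding cell_def by blast
qed

lemma Union_cells: "\<Union>(cell ` staircases t d) = convex hull ((\<lambda>c. real t *\<^sub>R v c) ` {..d})"
  using cell_subset_simplex simplex_subset_cells by blast

lemma independent_dilated: "\<not> affine_dependent ((\<lambda>c. real t *\<^sub>R v c) ` {..d})"
proof
  let ?w = "\<lambda>c. real t *\<^sub>R v c"
  have inj: "inj_on ?w {..d}" using inj_v t_pos by (auto simp: inj_on_def)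
  assume "affine_dependent (?w ` {..d})"
  then obtain u i where u: "(\<Sum>c\<le>d. u (?w c)) = 0" "(\<Sum>c\<le>d. u (?w c) *\<^sub>R ?w c) = 0"
    and i: "i \<le> d" "u (?w i) \<noteq> 0"
    by (auto simp: affine_dependent_explicit_finite sum.reindex[OF inj])
  have "u (?w i) * real t = 0"
    using u i(1) by (intro affine_coordinates_unique[where a = "\<lambda>c. u (?w c) * real t" and b = "\<lambda>_. 0"])
      (simp_all add: sum_distrib_right[symmetric])
  then show False using i(2) t_pos by simp
qed

lemma card_dilated: "card ((\<lambda>c. real t *\<^sub>R v c) ` {..d}) = Suc d"
  using inj_v t_pos by (subst card_image) (auto simp: inj_on_def)

lemma simplex_cells: "int d simplex \<Union>(cell ` staircases t d)"
  unfolding Union_cells simplex_def using independent_dilated card_dilated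
  by (intro exI[of _ "(\<lambda>c. real t *\<^sub>R v c) ` {..d}"]) simp

sublocale pure_box_complex "{..<t} \<times> {..d}" fst "{..<t}" "\<lambda>p. v (snd p)" "staircases t d" d
proof
  fix B assume B: "B \<in> staircases t d"
  show "\<exists>C\<in>staircases t d. B \<subseteq> C \<and> card C = card {..<t} + d" if "fst ` B = {..<t}"
    using staircase_extend[OF B that t_pos] by simp
  have "aff_dim (cell B) \<le> aff_dim ((\<lambda>c. real t *\<^sub>R v c) ` {..d})"
    using aff_dim_subset[OF cell_subset_simplex[of B]] by (simp add: aff_dim_convex_hull)
  also have "\<dots> \<le> int d"
    using aff_dim_le_card[of "(\<lambda>c. real t *\<^sub>R v c) ` {..d}"] card_dilated by simp
  finally show "aff_dim (cell B) \<le> int d" .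
qed

lemma shellable_staircase_cells: "shellable (cell ` staircases t d)"
proof (rule shellable_cells[where \<sigma> = height and D = corners])
  have M: "B \<in> staircases t d" "fst ` B = {..<t}" "card B = t + d" if "B \<in> maximal_boxes" for B
    using that by (auto simp: maximal_boxes_def)
  show "maximal_boxes \<noteq> {}"
    using ex_maximal_staircase[OF t_pos, of d] by (auto simp: maximal_boxes_def)
  fix B assume B: "B \<in> maximal_boxes"
  show "corners B \<subseteq> removable B"
    by (force simp: corners_def removable_def)
  fix p assume p: "p \<in> corners B"
  show "\<exists>q\<in>removable B - corners B. fst p = fst q"
  proof -
    obtain k c c' where kc: "p = (k, c)" "(k, c) \<in> B" "(k, c') \<in> B" "c < c'"
      using p by (auto simp: corners_def)
    \<comment> \<open>Only the leftmost point of a row can be a corner.\<close>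
    then have "(k, c') \<notin> corners B" by (auto simp: corners_def)
    moreover have "(k, c') \<in> removable B" using kc unfolding removable_def by force
    ultimately show ?thesis using kc(1) by force
  qed
  show "\<exists>C\<in>maximal_boxes. B - {p} \<subseteq> C \<and> height C < height B"
  proof -
    obtain C where C: "C \<in> staircases t d" "B - {p} \<subseteq> C" "card C = card B" "height C < height B"
      using flip_corner[OF M(1)[OF B] p] by metis
    have "p \<in> removable B" using p by (force simp: corners_def removable_def)
    moreover have "p \<in> B" using p by (auto simp: corners_def)
    ultimately have "fst ` (B - {p}) = {..<t}" using removable_iff M(2)[OF B] by blast
    then have "{..<t} \<subseteq> fst ` C" using image_mono[OF C(2), of fst] by simp
    moreover have "fst ` C \<subseteq> {..<t}" using staircases_subset[OF C(1)] by auto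
    ultimately have "fst ` C = {..<t}" by blast
    then show ?thesis using C M(3)[OF B] by (auto simp: maximal_boxes_def)
  qed
next
  fix B C assume BC: "B \<in> maximal_boxes" "C \<in> maximal_boxes" "C \<noteq> B" "height C \<le> height B"
  then have *: "B \<in> staircases t d" "card B = t + d" "C \<in> staircases t d" "card C = t + d"
    "fst ` B = {..<t}"
    by (auto simp: maximal_boxes_def)
  show "\<exists>p\<in>corners B. p \<notin> C" if "fst ` (B \<inter> C) = {..<t}"
    using corner_separates[OF *(1-4) BC(3,4) that] .
  show "corners B \<noteq> {}"
    using corners_nonempty[OF *(1-4) BC(3,4) t_pos *(5)] .
qed

end

section \<open>The cells of the Veronese complex\<close>

text \<open>The point \<open>(k, c)\<close> of a staircase stands for the variable \<open>x_(c + k + 1)\<close> in the \<open>k\<close>-th factor,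
  counting from \<open>0\<close>.\<close>

definition path_label :: "nat \<Rightarrow> (nat \<Rightarrow> nat) \<Rightarrow> 'k::field mpoly" where
  "path_label t a = (\<Prod>k<t. var (a k + k + 1))"

definition box_labels :: "nat \<Rightarrow> (nat \<times> nat) set \<Rightarrow> 'k::field mpoly set" where
  "box_labels t B = {path_label t a | a. \<forall>k<t. (k, a k) \<in> B}"

lemma path_label_cong: "(\<And>k. k < t \<Longrightarrow> a k = b k) \<Longrightarrow> path_label t a = path_label t b"
  by (simp add: path_label_def)

lemma box_labels_cong:
  assumes "\<And>k c. k < t \<Longrightarrow> (k, c) \<in> B \<longleftrightarrow> (k, c) \<in> C"
  shows "box_labels t B = box_labels t C"
  using assms by (auto simp: box_labels_def)

lemma box_labels_Suc:
  "box_labels (Suc n) B =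
    {v * w | v w. v \<in> box_labels n B \<and> w \<in> (\<lambda>c. var (c + n + 1)) ` {c. (n, c) \<in> B}}"
proof (intro equalityI subsetI)
  fix u :: "'a mpoly" assume "u \<in> box_labels (Suc n) B"
  then obtain a where "u = path_label (Suc n) a" "\<forall>k<Suc n. (k, a k) \<in> B"
    by (auto simp: box_labels_def)
  then have "u = path_label n a * var (a n + n + 1)" "path_label n a \<in> box_labels n B"
    "(n, a n) \<in> B"
    by (auto simp: path_label_def box_labels_def)
  then show "u \<in> {v * w | v w. v \<in> box_labels n B \<and> w \<in> (\<lambda>c. var (c + n + 1)) ` {c. (n, c) \<in> B}}"
    by blast
next
  fix u :: "'a mpoly"
  assume "u \<in> {v * w | v w. v \<in> box_labels n B \<and> w \<in> (\<lambda>c. var (c + n + 1)) ` {c. (n, c) \<in> B}}"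
  then obtain a c where ac: "u = path_label n a * var (c + n + 1)" "\<forall>k<n. (k, a k) \<in> B" "(n, c) \<in> B"
    by (auto simp: box_labels_def)
  have "path_label n a = (path_label n (a(n := c)) :: 'a mpoly)" by (intro path_label_cong) simp
  then have "u = path_label (Suc n) (a(n := c))" using ac(1) by (simp add: path_label_def)
  moreover have "\<forall>k<Suc n. (k, (a(n := c)) k) \<in> B" using ac by (auto simp: less_Suc_eq)
  ultimately show "u \<in> box_labels (Suc n) B" unfolding box_labels_def by blast
qed

text \<open>Peels off the last row, which corresponds to the simplex factor of the recursion.
  \<open>M\<close> is the last column used before it and fixes the index of the union.\<close>

lemma staircase_Suc_split:
  assumes "B \<in> staircases (Suc n) d"
  obtains M where "M \<le> d" "B \<inter> {..<n} \<times> UNIV \<in> staircases n M" "\<And>c. (n, c) \<in> B \<Longrightarrow> M \<le> c \<and> c \<le> d"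
proof -
  \<comment> \<open>The element 0 is the default when the earlier rows are empty.\<close>
  let ?C = "insert 0 {c. \<exists>k<n. (k, c) \<in> B}"
  have "?C \<subseteq> {..d}" using staircases_subset[OF assms] by auto
  then have fin: "finite ?C" by (rule finite_subset) simp
  define M where "M = Max ?C"
  have M: "M \<in> ?C" "\<And>c. c \<in> ?C \<Longrightarrow> c \<le> M"
    unfolding M_def using Max_in[OF fin] Max_ge[OF fin] by blast+
  have "M \<le> d" using M(1) \<open>?C \<subseteq> {..d}\<close> by blast
  moreover have "B \<inter> {..<n} \<times> UNIV \<in> staircases n M"
    using staircases_down[OF assms, of "B \<inter> {..<n} \<times> UNIV"] M(2) by (auto simp: staircases_def)
  moreover have "M \<le> c \<and> c \<le> d" if "(n, c) \<in> B" for c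
    using M(1) staircasesD[OF assms _ that] staircases_subset[OF assms] that by auto
  ultimately show ?thesis using that by blast
qed

lemma staircase_Suc_join:
  assumes "B \<in> staircases n M" "M \<le> d" "H \<subseteq> {M..d}"
  shows "B \<union> {n} \<times> H \<in> staircases (Suc n) d"
  using assms unfolding staircases_def by (fastforce dest: subsetD)

text \<open>Each factor of a cell is a row. The index \<open>i\<close> of the union is a cut at
  column \<open>i - n\<close>: earlier rows end there at the latest and row \<open>n\<close>, whose
  column \<open>c\<close> is the variable \<open>c + n + 1\<close>, begins there at the earliest.
  Staircases missing a row give the empty label set.\<close>

lemma veronese_complex_eq:
  assumes "1 \<le> q" "q \<le> p"
  shows "veronese_complex p q = (box_labels q ` staircases q (p - q) :: 'k::field mpoly set set)"
  using assms
proof (induction q arbitrary: p rule: nat_induct_at_least)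
  case base
  have labels: "box_labels 1 B = (\<lambda>c. var (Suc c) :: 'k mpoly) ` {c. (0, c) \<in> B}" for B
    unfolding One_nat_def box_labels_Suc by (auto simp: box_labels_def path_label_def)
  have "{1..p} = Suc ` {..p - 1}" using base by (simp add: image_Suc_atMost)
  then have var: "var ` {1..p} = (\<lambda>c. var (Suc c) :: 'k mpoly) ` {..p - 1}" by (simp only: image_image)
  have "Pow ((\<lambda>c. var (Suc c) :: 'k mpoly) ` {..p - 1}) = box_labels 1 ` staircases 1 (p - 1)"
  proof (intro equalityI subsetI)
    fix X :: "'k mpoly set" assume "X \<in> Pow ((\<lambda>c. var (Suc c)) ` {..p - 1})"
    then obtain H where H: "H \<subseteq> {..p - 1}" "X = (\<lambda>c. var (Suc c)) ` H"
      by (auto elim: subset_imageE)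
    then have "{0} \<times> H \<in> staircases 1 (p - 1)" by (auto simp: staircases_def)
    moreover have "X = box_labels 1 ({0} \<times> H)" using H(2) unfolding labels by simp
    ultimately show "X \<in> box_labels 1 ` staircases 1 (p - 1)" by blast
  next
    fix X :: "'k mpoly set" assume "X \<in> box_labels 1 ` staircases 1 (p - 1)"
    then show "X \<in> Pow ((\<lambda>c. var (Suc c)) ` {..p - 1})"
      unfolding labels using staircases_subset by fast
  qed
  then show ?case
    unfolding var[symmetric] by (simp add: label_simplex_def)
next
  case (Suc n)
  obtain n' where n': "n = Suc n'" using Suc.hyps by (cases n) auto
  have \<Gamma>: "veronese_complex p (Suc n) =
    (\<Union>i\<in>{n..p - 1}. label_prod (box_labels n ` staircases n (i - n))
      (Pow (var ` {i+1..p})) :: 'k mpoly set set)"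
    using Suc.IH unfolding n' by (simp add: label_simplex_def)
  show ?case
  proof (intro equalityI subsetI)
    fix X :: "'k mpoly set" assume "X \<in> veronese_complex p (Suc n)"
    then obtain i B G where i: "n \<le> i" "i \<le> p - 1" and B: "B \<in> staircases n (i - n)"
      and G: "G \<subseteq> (var ` {i+1..p} :: 'k mpoly set)"
      and X: "X = {v * w | v w. v \<in> box_labels n B \<and> w \<in> G}"
      unfolding \<Gamma> label_prod_def by auto
    obtain H where H: "H \<subseteq> {i+1..p}" "G = var ` H" using G by (rule subset_imageE)
    let ?H = "{c. c + n + 1 \<in> H}"
    have HI: "?H \<subseteq> {i - n..p - Suc n}" using H(1) i by fastforce
    have G': "G = (\<lambda>c. var (c + n + 1)) ` ?H"
    proof -
      have "j \<in> (\<lambda>c. c + n + 1) ` ?H" if "j \<in> H" for j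
        using that H(1) i by (intro image_eqI[of _ _ "j - n - 1"]) auto
      then have "H = (\<lambda>c. c + n + 1) ` ?H" by auto
      then have "var ` H = (var ` (\<lambda>c. c + n + 1) ` ?H :: 'k mpoly set)" by (rule arg_cong)
      then show ?thesis unfolding H(2) image_image .
    qed
    let ?B = "B \<union> {n} \<times> ?H"
    have "?B \<in> staircases (Suc n) (p - Suc n)"
      using i by (intro staircase_Suc_join[OF B _ HI]) simp
    moreover have "X = box_labels (Suc n) ?B"
    proof -
      have "box_labels n ?B = (box_labels n B :: 'k mpoly set)" by (intro box_labels_cong) auto
      moreover have "{c. (n, c) \<in> ?B} = ?H" using staircases_subset[OF B] by auto
      ultimately show ?thesis unfolding box_labels_Suc X G' by simp
    qed
    ultimately show "X \<in> box_labels (Suc n) ` staircases (Suc n) (p - Suc n)" by blast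
  next
    fix X :: "'k mpoly set" assume "X \<in> box_labels (Suc n) ` staircases (Suc n) (p - Suc n)"
    then obtain B where B: "B \<in> staircases (Suc n) (p - Suc n)" "X = box_labels (Suc n) B" by blast
    then obtain M where M: "M \<le> p - Suc n" "B \<inter> {..<n} \<times> UNIV \<in> staircases n M"
      "\<And>c. (n, c) \<in> B \<Longrightarrow> M \<le> c \<and> c \<le> p - Suc n"
      using staircase_Suc_split by metis
    \<comment> \<open>The cut is placed as early as the previous rows allow.\<close>
    let ?i = "M + n" and ?F = "box_labels n (B \<inter> {..<n} \<times> UNIV) :: 'k mpoly set"
    let ?G = "(\<lambda>c. var (c + n + 1)) ` {c. (n, c) \<in> B} :: 'k mpoly set"
    have "X = {v * w | v w. v \<in> ?F \<and> w \<in> ?G}"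
    proof -
      have "box_labels n B = ?F" by (intro box_labels_cong) auto
      then show ?thesis by (simp add: B(2) box_labels_Suc)
    qed
    moreover have "?F \<in> box_labels n ` staircases n (?i - n)" using M(2) by simp
    moreover have "?G \<subseteq> var ` {?i+1..p}"
    proof clarify
      fix c assume "(n, c) \<in> B"
      then have "c + n + 1 \<in> {?i+1..p}" using M(3)[of c] Suc.prems by auto
      then show "var (c + n + 1) \<in> (var ` {?i+1..p} :: 'k mpoly set)" by (rule imageI)
    qed
    moreover have "?i \<in> {n..p - 1}" using M(1) Suc.prems by auto
    ultimately show "X \<in> veronese_complex p (Suc n)" unfolding \<Gamma> label_prod_def by blast
  qed
qed

section \<open>Recovering a path from its label\<close>

lemma inj_on_prod_var: "inj_on (\<lambda>S. \<Prod>i\<in>S. var i :: 'k::field mpoly) {S. finite S}"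
proof (rule inj_onI)
  fix S T :: "nat set"
  assume "S \<in> {S. finite S}" "T \<in> {S. finite S}" and eq: "(\<Prod>i\<in>S. var i :: 'k mpoly) = (\<Prod>i\<in>T. var i)"
  then have fin: "finite S" "finite T" by auto
  have lookup: "Poly_Mapping.lookup (\<Sum>i\<in>S. Poly_Mapping.single i (1::nat)) i = (if i \<in> S then 1 else 0)"
    if "finite S" for S i
    using that by (induction S) (auto simp: lookup_add lookup_single when_def)
  have sums: "(\<Sum>i\<in>S. Poly_Mapping.single i (1::nat)) = (\<Sum>i\<in>T. Poly_Mapping.single i 1)"
    using eq unfolding prod_var by (rule injD[OF inj_monomial])
  have "(if i \<in> S then 1 else 0 :: nat) = (if i \<in> T then 1 else 0)" for i
    unfolding lookup[OF fin(1), symmetric] lookup[OF fin(2), symmetric] sums ..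
  then have "(i \<in> S) = (i \<in> T)" for i by (metis zero_neq_one)
  then show "S = T" by blast
qed

text \<open>The shift by \<open>k\<close> makes the indices strictly increasing, so they are
  distinct and sorting the set of variables gives them back in order.\<close>

lemma path_label_inject:
  assumes "path_label t a = (path_label t b :: 'k::field mpoly)"
    and "mono_on {..<t} a" "mono_on {..<t} b" "k < t"
  shows "a k = b k"
proof -
  let ?s = "\<lambda>a k :: nat. a k + k + 1"
  have strict: "strict_mono_on {..<t} (?s a)" if "mono_on {..<t} a" for a :: "nat \<Rightarrow> nat"
    by (rule strict_mono_onI) (use mono_onD[OF that] in \<open>simp add: add_le_less_mono\<close>)
  have label: "path_label t a = (\<Prod>i\<in>?s a ` {..<t}. var i :: 'k mpoly)" if "mono_on {..<t} a" for a
    using prod.reindex[OF strict_mono_on_imp_inj_on[OF strict[OF that]], of "var :: nat \<Rightarrow> 'k mpoly"]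
    by (simp add: path_label_def)
  have "?s a ` {..<t} = ?s b ` {..<t}"
    using assms(1) unfolding label[OF assms(2)] label[OF assms(3)]
    by (rule inj_onD[OF inj_on_prod_var]) auto
  then have "set (map (?s a) [0..<t]) = set (map (?s b) [0..<t])"
    by (simp add: atLeast0LessThan)
  moreover have "sorted (map (?s a) [0..<t])" "distinct (map (?s a) [0..<t])" if "mono_on {..<t} a" for a
    using strict_mono_on_imp_inj_on[OF strict[OF that]] that
    by (auto simp: distinct_map atLeast0LessThan sorted_iff_nth_mono mono_on_def intro!: add_mono)
  ultimately have "map (?s a) [0..<t] = map (?s b) [0..<t]"
    using assms(2,3) by (intro sorted_distinct_set_unique)
  then have "\<forall>j\<in>set [0..<t]. ?s a j = ?s b j" by (simp only: map_eq_conv)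
  then show ?thesis using assms(4) by simp
qed

lemma staircase_path_mono:
  assumes "B \<in> staircases t d" "\<forall>k<t. (k, a k) \<in> B"
  shows "mono_on {..<t} a"
proof (rule mono_onI)
  fix i j assume "i \<in> {..<t}" "j \<in> {..<t}" "i \<le> j"
  then show "a i \<le> a j" using staircasesD[OF assms(1), of i "a i" j "a j"] assms(2) by (cases "i = j") auto
qed

section \<open>Placing the labels in space\<close>

context staircase_realization
begin

text \<open>Monotonicity makes the chosen path unique on the relevant indices: for
  \<open>t = 2\<close> the columns 2, 0 have the same label as 1, 1. Monomials that label no path
  get an arbitrary point.\<close>

definition realize :: "'k::field mpoly \<Rightarrow> 'a" where
  "realize u = (\<Sum>k<t. v ((SOME a. mono_on {..<t} a \<and> path_label t a = u) k))"

lemma realize_path_label: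
  assumes "mono_on {..<t} a"
  shows "realize (path_label t a :: 'k::field mpoly) = (\<Sum>k<t. v (a k))"
proof -
  let ?b = "SOME b. mono_on {..<t} b \<and> path_label t b = (path_label t a :: 'k mpoly)"
  have "mono_on {..<t} ?b \<and> path_label t ?b = (path_label t a :: 'k mpoly)"
    by (rule someI[of _ a]) (use assms in simp)
  then have "?b k = a k" if "k < t" for k using path_label_inject assms that by blast
  then show ?thesis by (simp add: realize_def)
qed

lemma path_points:
  "{\<Sum>k\<in>{..<t}. v (snd (a k)) | a. \<forall>k\<in>{..<t}. a k \<in> B \<and> fst (a k) = k} =
    {\<Sum>k<t. v (a k) | a. \<forall>k<t. (k, a k) \<in> B}"
proof (intro equalityI subsetI)
  fix x assume "x \<in> {\<Sum>k\<in>{..<t}. v (snd (a k)) | a. \<forall>k\<in>{..<t}. a k \<in> B \<and> fst (a k) = k}"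
  then obtain a where a: "x = (\<Sum>k<t. v (snd (a k)))" "\<And>k. k < t \<Longrightarrow> a k \<in> B \<and> fst (a k) = k"
    by auto
  then have "\<forall>k<t. (k, snd (a k)) \<in> B" by (metis prod.collapse)
  then show "x \<in> {\<Sum>k<t. v (a k) | a. \<forall>k<t. (k, a k) \<in> B}"
    using a(1) by (intro CollectI exI[of _ "\<lambda>k. snd (a k)"]) simp
next
  fix x assume "x \<in> {\<Sum>k<t. v (a k) | a. \<forall>k<t. (k, a k) \<in> B}"
  then obtain a where a: "x = (\<Sum>k<t. v (a k))" "\<forall>k<t. (k, a k) \<in> B" by blast
  then show "x \<in> {\<Sum>k\<in>{..<t}. v (snd (a k)) | a. \<forall>k\<in>{..<t}. a k \<in> B \<and> fst (a k) = k}"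
    by (intro CollectI exI[of _ "\<lambda>k. (k, a k)"]) simp
qed

lemma realize_box_labels:
  assumes "B \<in> staircases t d"
  shows "realize ` (box_labels t B :: 'k::field mpoly set) = {\<Sum>k<t. v (a k) | a. \<forall>k<t. (k, a k) \<in> B}"
proof -
  have "realize (path_label t a :: 'k mpoly) = (\<Sum>k<t. v (a k))" if "\<forall>k<t. (k, a k) \<in> B" for a
    using realize_path_label staircase_path_mono[OF assms that] .
  then show ?thesis unfolding box_labels_def by (auto simp: image_iff) metis+
qed

lemma hull_box_labels:
  assumes "B \<in> staircases t d"
  shows "convex hull (realize ` (box_labels t B :: 'k::field mpoly set)) = cell B"
  using cell_eq_hull[OF staircases_subset[OF assms]]
  unfolding path_points realize_box_labels[OF assms] by simp

lemma realized_cells_eq: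
  "realized_cells (box_labels t ` staircases t d) (realize :: 'k::field mpoly \<Rightarrow> 'a) = cell ` staircases t d"
  unfolding realized_cells_def image_image using hull_box_labels by (intro image_cong refl)

text \<open>The graph of a path is a staircase whose cell is a single point. Equal points are equal
  cells, and cells determine their supports.\<close>

lemma path_points_inject:
  assumes a: "A \<in> staircases t d" "\<forall>k<t. (k, a k) \<in> A" and b: "B \<in> staircases t d" "\<forall>k<t. (k, b k) \<in> B"
    and eq: "(\<Sum>k<t. v (a k)) = (\<Sum>k<t. v (b k))" and "k < t"
  shows "a k = b k"
proof -
  let ?G = "\<lambda>a. (\<lambda>k. (k, a k :: nat)) ` {..<t}"
  have G: "?G a \<in> staircases t d" if "A \<in> staircases t d" "\<forall>k<t. (k, a k) \<in> A" for A a
    by (rule staircases_down[OF that(1)]) (use that(2) in auto)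
  have "cell (?G a) = {\<Sum>k<t. v (a k)}" if "A \<in> staircases t d" "\<forall>k<t. (k, a k) \<in> A" for A a
  proof -
    have "{\<Sum>k<t. v (c k) | c. \<forall>k<t. (k, c k) \<in> ?G a} = {\<Sum>k<t. v (a k)}"
    proof (intro equalityI subsetI)
      fix x assume "x \<in> {\<Sum>k<t. v (c k) | c. \<forall>k<t. (k, c k) \<in> ?G a}"
      then obtain c where "x = (\<Sum>k<t. v (c k))" "\<forall>k<t. (k, c k) \<in> ?G a" by blast
      then show "x \<in> {\<Sum>k<t. v (a k)}" by (auto intro!: sum.cong)
    qed auto
    then show ?thesis
      using cell_eq_hull[OF staircases_subset[OF G[OF that]]] by (simp add: path_points)
  qed
  then have "cell (?G a) \<subseteq> cell (?G b)" using a b eq by simp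
  moreover have "fst ` ?G a = {..<t}" by (simp add: image_image)
  ultimately have "?G a \<subseteq> ?G b" using cell_subset_iff[OF G[OF a] G[OF b]] by simp
  then show ?thesis using \<open>k < t\<close> by auto
qed

lemma polytopal_realization_staircases:
  "polytopal_realization (box_labels t ` staircases t d) (realize :: 'k::field mpoly \<Rightarrow> 'a)"
  unfolding polytopal_realization_def realized_cells_eq
proof (intro conjI ballI polytopal_complex_cells)
  show "inj_on realize (\<Union>(box_labels t ` staircases t d) :: 'k mpoly set)"
  proof (rule inj_onI)
    fix x y :: "'k mpoly"
    assume xy: "x \<in> \<Union>(box_labels t ` staircases t d)" "y \<in> \<Union>(box_labels t ` staircases t d)"
      and eq: "realize x = realize y"
    obtain A a where a: "A \<in> staircases t d" "\<forall>k<t. (k, a k) \<in> A" "x = path_label t a"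
      using xy(1) by (auto simp: box_labels_def)
    obtain B b where b: "B \<in> staircases t d" "\<forall>k<t. (k, b k) \<in> B" "y = path_label t b"
      using xy(2) by (auto simp: box_labels_def)
    have "(\<Sum>k<t. v (a k)) = (\<Sum>k<t. v (b k))"
      using eq realize_path_label[OF staircase_path_mono[OF a(1,2)], where 'k = 'k]
        realize_path_label[OF staircase_path_mono[OF b(1,2)], where 'k = 'k]
      by (simp add: a(3) b(3))
    then show "x = y"
      unfolding a(3) b(3) by (intro path_label_cong path_points_inject[OF a(1,2) b(1,2)])
  qed
  fix F :: "'k mpoly set" assume "F \<in> box_labels t ` staircases t d"
  then obtain B where B: "B \<in> staircases t d" "F = box_labels t B" by blast
  show "{x. x extreme_point_of convex hull (realize ` F)} = realize ` F"
    unfolding B(2) hull_box_labels[OF B(1)]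
    unfolding extreme_points_cell[OF B(1)] path_points realize_box_labels[OF B(1)] ..
qed

lemma extreme_points_Union:
  "{x. x extreme_point_of \<Union>(cell ` staircases t d)} = (\<lambda>c. real t *\<^sub>R v c) ` {..d}"
  unfolding Union_cells using extreme_point_of_convex_hull_affine_independent[OF independent_dilated] by auto

text \<open>Staying in column \<open>c\<close> means taking the variables \<open>c + 1\<close> to
  \<open>c + t\<close>: these labels sit at the vertices of the dilated simplex.\<close>

lemma constant_path:
  assumes "c \<le> d"
  shows "path_label t (\<lambda>_. c) \<in> \<Union>(box_labels t ` staircases t d)"
    and "realize (path_label t (\<lambda>_. c) :: 'k::field mpoly) = real t *\<^sub>R v c"
proof -
  have "{..<t} \<times> {c} \<in> staircases t d" using assms by (auto simp: staircases_def)
  moreover have "path_label t (\<lambda>_. c) \<in> box_labels t ({..<t} \<times> {c})"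
    unfolding box_labels_def by (intro CollectI exI[of _ "\<lambda>_. c"]) simp
  ultimately show "path_label t (\<lambda>_. c) \<in> \<Union>(box_labels t ` staircases t d)" by blast
  show "realize (path_label t (\<lambda>_. c) :: 'k mpoly) = real t *\<^sub>R v c"
    by (subst realize_path_label) (auto simp: mono_on_def sum_constant_scaleR)
qed

end

section \<open>Assembly in a subspace of dimension \<open>m - t\<close>\<close>

text \<open>Supplies the points \<open>v c\<close>. The subspace stands for the Euclidean space of
  dimension \<open>m - t\<close>, since a type cannot depend on \<open>m\<close> and
  \<open>t\<close>.\<close>

lemma subspace_affine_basis:
  fixes E :: "'a::euclidean_space set"
  assumes "subspace E"
  obtains v :: "nat \<Rightarrow> 'a" where "inj_on v {..dim E}" "v ` {..dim E} \<subseteq> E" "\<not> affine_dependent (v ` {..dim E})"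
proof -
  obtain B where B: "B \<subseteq> E" "\<not> affine_dependent B" "affine hull E = affine hull B"
    using affine_basis_exists by blast
  then have "int (card B) = aff_dim E + 1" by (intro aff_dim_unique) simp
  then have card: "card B = Suc (dim E)" using aff_dim_subspace[OF assms] by simp
  then have "finite B" using card_ge_0_finite by force
  then obtain v where "bij_betw v {0..<Suc (dim E)} B" using ex_bij_betw_nat_finite card by metis
  then have "bij_betw v {..dim E} B" by (simp add: atLeast0LessThan lessThan_Suc_atMost)
  then show ?thesis using that B by (auto simp: bij_betw_def)
qed

theorem proposition3p6:
  fixes m t :: nat
    and E :: "'a::euclidean_space set"
  assumes "1 \<le> t" and "t \<le> m"
    and "subspace E" and "dim E = m - t"
  shows "\<exists>\<phi> :: 'k::field mpoly \<Rightarrow> 'a.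
    \<phi> ` \<Union>(veronese_complex m t) \<subseteq> E \<and>
    realizes_subdivision_of_simplex (veronese_complex m t) (m - t)
      {\<Prod>j\<in>{i..<i+t}. var j | i. i \<in> {1..m-t+1}} \<phi> \<and>
    shellable (realized_cells (veronese_complex m t) \<phi>) \<and>
    \<Union>(realized_cells (veronese_complex m t) \<phi>) homeomorphic (cball 0 1 \<inter> E)"
proof -
  let ?d = "m - t"
  obtain v where v: "inj_on v {..?d}" "v ` {..?d} \<subseteq> E" "\<not> affine_dependent (v ` {..?d})"
    using subspace_affine_basis[OF assms(3)] unfolding assms(4) by metis
  interpret staircase_realization t ?d v using assms(1) v by unfold_locales auto
  let ?\<phi> = "realize :: 'k mpoly \<Rightarrow> 'a"
  let ?X = "box_labels t ` staircases t ?d :: 'k mpoly set set"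
  let ?U = "{\<Prod>j\<in>{i..<i+t}. var j | i. i \<in> {1..m-t+1}} :: 'k mpoly set"
  have X: "veronese_complex m t = ?X" using veronese_complex_eq assms(1,2) .
  have "?\<phi> ` \<Union>?X \<subseteq> E"
  proof clarify
    fix B u assume B: "B \<in> staircases t ?d" and u: "u \<in> (box_labels t B :: 'k mpoly set)"
    have "?\<phi> u \<in> {\<Sum>k<t. v (a k) | a. \<forall>k<t. (k, a k) \<in> B}"
      using imageI[OF u, of ?\<phi>] unfolding realize_box_labels[OF B] .
    then obtain a where a: "?\<phi> u = (\<Sum>k<t. v (a k))" "\<forall>k<t. (k, a k) \<in> B" by blast
    then show "?\<phi> u \<in> E"
      unfolding a(1) using v(2) staircases_subset[OF B] by (intro subspace_sum[OF assms(3)]) auto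
  qed
  moreover have "realizes_subdivision_of_simplex ?X ?d ?U ?\<phi>"
  proof -
    have U: "?U = (\<lambda>c. path_label t (\<lambda>_. c)) ` {..?d}"
    proof -
      have label: "(\<Prod>j\<in>{Suc c..<Suc c + t}. var j) = (path_label t (\<lambda>_. c) :: 'k mpoly)" for c
        unfolding prod.atLeastLessThan_shift_0[of _ "Suc c"]
        by (simp add: path_label_def atLeast0LessThan add_ac)
      have "?U = (\<lambda>i. \<Prod>j\<in>{i..<i+t}. var j) ` {1..?d+1}" by blast
      also have "\<dots> = (\<lambda>i. \<Prod>j\<in>{i..<i+t}. var j) ` Suc ` {..?d}" by (simp add: image_Suc_atMost)
      finally show ?thesis unfolding image_image label .
    qed
    have "?\<phi> ` ?U = (\<lambda>c. real t *\<^sub>R v c) ` {..?d}"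
      unfolding U image_image using constant_path(2) by (intro image_cong) auto
    moreover have "?U \<subseteq> \<Union>?X" unfolding U using constant_path(1) by blast
    ultimately show ?thesis
      unfolding realizes_subdivision_of_simplex_def realized_cells_eq extreme_points_Union
      using polytopal_realization_staircases simplex_cells by blast
  qed
  moreover have "shellable (realized_cells ?X ?\<phi>)"
    unfolding realized_cells_eq by (rule shellable_staircase_cells)
  moreover have "\<Union>(realized_cells ?X ?\<phi>) homeomorphic (cball 0 1 \<inter> E)"
    unfolding realized_cells_eq
  proof (rule homeomorphic_convex_compact_sets)
    show "convex (\<Union>(cell ` staircases t ?d))" "compact (\<Union>(cell ` staircases t ?d))"
      unfolding Union_cells by (auto intro: finite_imp_compact_convex_hull)
    show "convex (cball 0 1 \<inter> E)" "compact (cball 0 1 \<inter> E)"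
      using assms(3) by (auto intro: convex_Int subspace_imp_convex compact_Int_closed closed_subspace)
    \<comment> \<open>The ball is a neighbourhood of the origin, a point of \<open>E\<close>, so the
      intersection keeps the full dimension; compact convex sets of equal dimension are
      homeomorphic.\<close>
    have "aff_dim (E \<inter> cball 0 1) = aff_dim E"
      using subspace_0[OF assms(3)]
      by (intro aff_dim_convex_Int_nonempty_interior subspace_imp_convex[OF assms(3)]) force
    then show "aff_dim (\<Union>(cell ` staircases t ?d)) = aff_dim (cball 0 1 \<inter> E)"
      using aff_dim_simplex[OF simplex_cells] aff_dim_subspace[OF assms(3)] assms(4)
      by (simp add: Int_commute)
  qed
  ultimately show ?thesis unfolding X by blast
qed

end
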